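(* For every $n\ge1$, the dual labeling $\lambda_\bullet^*$ is an EL-labeling of the order dual $(\Pi_n^\bullet)^*$. Consequently the maximal intervals of the order dual are EL-shellable.
   Context: A pointed set is a pair $(A,p)$, written $A^p$, with $A$ nonempty finite and $p\in A$. A pointed partition of $[n]$ is a collection of pointed sets whose underlying sets form a set partition of $[n]$. In $\Pi_n^\bullet$, $\pi\lessdot\pi'$ exactly when $\pi'$ is obtained from $\pi$ by replacing two blocks $A^p,B^q$ (with $\min A<\min B$) by $(A\cup B)^p$ (a $1$-merge) or $(A\cup B)^q$ (a $0$-merge), other blocks unchanged. The labeling $\lambda_\bullet$ assigns to a $u$-merge the label $(\min A,\min B)^u$, valued in the poset $\Lambda_n^\bullet$ with elements $(a,b)^u$ ($1\le a<b\le n$, $u\in\{0,1\}$), ordered as the ordinal sum $A_1\oplus C_1\oplus\cdots\oplus A_{n-1}\oplus C_{n-1}$, where $A_a$ is the antichain $\{(a,b)^0\}$ and $C_a$ the chain $\{(a,b)^1\}$ with $(a,b)^1<(a,c)^1$ iff $b<c$. For a poset $P$ with edge labeling $\lambda:\mathcal{E}(P)\to\Lambda$, the order dual $P^*$ has reversed order, and the dual labeling $\lambda^*:\mathcal{E}(P^* )\to\Lambda^*$ is $\lambda^*(y\lessdot_{P^*}x)=\lambda(x\lessdot_P y)$, where $\Lambda^*$ is the order dual of $\Lambda$. An edge labeling is an EL-labeling if every closed interval has a unique increasing maximal chain (consecutive labels strictly increasing) whose label sequence lexicographically precedes that of every other maximal chain of the interval. *)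

theory Defs
  imports Main "HOL-Library.Disjoint_Sets"
begin

section \<open>Posets and EL-labelings\<close>

text \<open>A poset is a relation \<open>P\<close> with \<^prop>\<open>Partial_order P\<close>; its underlying set is \<^term>\<open>Field P\<close>
  (\<open>P\<close> is reflexive there) and its order dual is \<^term>\<open>P\<inverse>\<close>.\<close>

definition covers :: "'a rel \<Rightarrow> 'a \<Rightarrow> 'a \<Rightarrow> bool" where
  "covers P x y \<longleftrightarrow> (x, y) \<in> P \<and> x \<noteq> y \<and> (\<forall>z. (x, z) \<in> P \<and> (z, y) \<in> P \<longrightarrow> z = x \<or> z = y)"

definition closed_interval :: "'a rel \<Rightarrow> 'a \<Rightarrow> 'a \<Rightarrow> 'a set" where
  "closed_interval P x y = {z. (x, z) \<in> P \<and> (z, y) \<in> P}"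

definition closed_intervals :: "'a rel \<Rightarrow> 'a set set" where
  "closed_intervals P = {closed_interval P x y | x y. (x, y) \<in> P}"

definition maximal_intervals :: "'a rel \<Rightarrow> 'a set set" where
  "maximal_intervals P =
     {I \<in> closed_intervals P. \<forall>J \<in> closed_intervals P. I \<subseteq> J \<longrightarrow> J = I}"

text \<open>Maximal chains of the interval \<open>[x, y]\<close>, listed from \<open>x\<close> up to \<open>y\<close>.\<close>

definition maximal_chains :: "'a rel \<Rightarrow> 'a \<Rightarrow> 'a \<Rightarrow> 'a list set" where
  "maximal_chains P x y = {c. c \<noteq> [] \<and> hd c = x \<and> last c = y \<and> successively (covers P) c}"

text \<open>Edge labelings are functions of two arguments; only the values \<open>lab x y\<close> for
  \<^prop>\<open>covers P x y\<close> matter.\<close>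

definition edge_labeling :: "'a rel \<Rightarrow> 'l rel \<Rightarrow> ('a \<Rightarrow> 'a \<Rightarrow> 'l) \<Rightarrow> bool" where
  "edge_labeling P \<Lambda> lab \<longleftrightarrow> (\<forall>x y. covers P x y \<longrightarrow> lab x y \<in> Field \<Lambda>)"

definition dual_labeling :: "('a \<Rightarrow> 'a \<Rightarrow> 'l) \<Rightarrow> 'a \<Rightarrow> 'a \<Rightarrow> 'l" where
  "dual_labeling lab y x = lab x y"

definition label_sequence :: "('a \<Rightarrow> 'a \<Rightarrow> 'l) \<Rightarrow> 'a list \<Rightarrow> 'l list" where
  "label_sequence lab c = map2 lab (butlast c) (tl c)"

definition increasing_chain :: "'l rel \<Rightarrow> ('a \<Rightarrow> 'a \<Rightarrow> 'l) \<Rightarrow> 'a list \<Rightarrow> bool" where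
  "increasing_chain \<Lambda> lab c \<longleftrightarrow>
     successively (\<lambda>a b. (a, b) \<in> \<Lambda> \<and> a \<noteq> b) (label_sequence lab c)"

definition lex_precedes :: "'l rel \<Rightarrow> ('a \<Rightarrow> 'a \<Rightarrow> 'l) \<Rightarrow> 'a list \<Rightarrow> 'a list \<Rightarrow> bool" where
  "lex_precedes \<Lambda> lab c d \<longleftrightarrow>
     (label_sequence lab c, label_sequence lab d) \<in> lexord (\<Lambda> - Id)"

definition EL_labeling :: "'a rel \<Rightarrow> 'l rel \<Rightarrow> ('a \<Rightarrow> 'a \<Rightarrow> 'l) \<Rightarrow> bool" where
  "EL_labeling P \<Lambda> lab \<longleftrightarrow>
     Partial_order P \<and> Partial_order \<Lambda> \<and> edge_labeling P \<Lambda> lab \<and>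
     (\<forall>x y. (x, y) \<in> P \<longrightarrow>
        (\<exists>!c. c \<in> maximal_chains P x y \<and> increasing_chain \<Lambda> lab c) \<and>
        (\<forall>c \<in> maximal_chains P x y. increasing_chain \<Lambda> lab c \<longrightarrow>
           (\<forall>d \<in> maximal_chains P x y. d \<noteq> c \<longrightarrow> lex_precedes \<Lambda> lab c d)))"

text \<open>A finite bounded poset is EL-shellable if it has an EL-labeling with values in some poset.
  Since a finite poset has finitely many edges, restricting the label poset to the labels that
  occur and renaming them shows that label posets on subsets of \<^typ>\<open>nat\<close> suffice.\<close>

definition EL_shellable :: "'a rel \<Rightarrow> bool" where
  "EL_shellable P \<longleftrightarrow>
     Partial_order P \<and> finite (Field P) \<and>
     (\<exists>b \<in> Field P. \<exists>t \<in> Field P. \<forall>x \<in> Field P. (b, x) \<in> P \<and> (x, t) \<in> P) \<and>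
     (\<exists>(\<Lambda> :: nat rel) lab. EL_labeling P \<Lambda> lab)"

definition ordinal_sum :: "'a rel \<Rightarrow> 'a rel \<Rightarrow> 'a rel" where
  "ordinal_sum R S = R \<union> S \<union> Field R \<times> Field S"


section \<open>The poset of pointed partitions\<close>

text \<open>The pointed set \<open>A\<^sup>p\<close> is the pair \<open>(A, p)\<close>.\<close>

type_synonym pointed_set = "nat set \<times> nat"

definition pointed_partitions :: "nat \<Rightarrow> pointed_set set set" where
  "pointed_partitions n =
     {\<pi>. (\<forall>(A, p) \<in> \<pi>. A \<noteq> {} \<and> finite A \<and> p \<in> A) \<and> inj_on fst \<pi> \<and> partition_on {1..n} (fst ` \<pi>)}"

text \<open>The label \<open>(a, b)\<^sup>u\<close> is \<open>((a, b), u)\<close>.\<close>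

type_synonym label = "(nat \<times> nat) \<times> nat"

definition is_merge :: "label \<Rightarrow> pointed_set set \<Rightarrow> pointed_set set \<Rightarrow> bool" where
  "is_merge l \<pi> \<pi>' \<longleftrightarrow>
     (\<exists>A p B q u. (A, p) \<in> \<pi> \<and> (B, q) \<in> \<pi> \<and> Min A < Min B \<and> u \<in> {0, 1} \<and>
        l = ((Min A, Min B), u) \<and>
        \<pi>' = insert (A \<union> B, if u = 1 then p else q) (\<pi> - {(A, p), (B, q)}))"

definition pointed_partition_poset :: "nat \<Rightarrow> pointed_set set rel" where
  "pointed_partition_poset n =
     {(\<pi>, \<pi>'). \<pi> \<in> pointed_partitions n \<and> (\<lambda>\<sigma> \<tau>. \<exists>l. is_merge l \<sigma> \<tau>)\<^sup>*\<^sup>* \<pi> \<pi>'}"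

definition pointed_labeling :: "pointed_set set \<Rightarrow> pointed_set set \<Rightarrow> label" where
  "pointed_labeling \<pi> \<pi>' = (THE l. is_merge l \<pi> \<pi>')"

definition antichain_part :: "nat \<Rightarrow> nat \<Rightarrow> label rel" where
  "antichain_part n a = Id_on {((a, b), 0) | b. a < b \<and> b \<le> n}"

definition chain_part :: "nat \<Rightarrow> nat \<Rightarrow> label rel" where
  "chain_part n a = {(((a, b), 1), ((a, c), 1)) | b c. a < b \<and> b \<le> c \<and> c \<le> n}"

definition label_poset :: "nat \<Rightarrow> label rel" where
  "label_poset n =
     foldr (\<lambda>a R. ordinal_sum (antichain_part n a) (ordinal_sum (chain_part n a) R)) [1..<n] {}"


section \<open>The definitions agree with their informal descriptions\<close>

lemma pointed_partitionsD:
  assumes "\<pi> \<in> pointed_partitions n" and "(A, p) \<in> \<pi>"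
  shows "A \<noteq> {}" "finite A" "p \<in> A" "A \<subseteq> {1..n}"
proof -
  show "A \<noteq> {}" "finite A" "p \<in> A" using assms unfolding pointed_partitions_def by blast+
  have "A \<in> fst ` \<pi>" using assms by force
  then show "A \<subseteq> {1..n}"
    using assms unfolding pointed_partitions_def partition_on_def by blast
qed

lemma pointed_partitions_disjoint:
  assumes "\<pi> \<in> pointed_partitions n" "(A, p) \<in> \<pi>" "(B, q) \<in> \<pi>" "(A, p) \<noteq> (B, q)"
  shows "A \<inter> B = {}"
proof -
  have "inj_on fst \<pi>" using assms by (simp add: pointed_partitions_def)
  then have "A \<noteq> B" using assms inj_onD[of fst \<pi> "(A, p)" "(B, q)"] by auto
  moreover have "disjoint (fst ` \<pi>)" using assms by (auto simp: pointed_partitions_def partition_on_def)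
  moreover have "A \<in> fst ` \<pi>" "B \<in> fst ` \<pi>" using assms by force+
  ultimately show ?thesis by (auto simp: disjoint_def)
qed

lemma finite_pointed_partition:
  assumes "\<pi> \<in> pointed_partitions n" shows "finite \<pi>"
proof -
  have "fst ` \<pi> \<subseteq> Pow {1..n}" and "inj_on fst \<pi>"
    using assms by (auto simp: pointed_partitions_def partition_on_def)
  then show ?thesis using finite_imageD finite_subset by blast
qed

lemma merge_new_block:
  assumes "\<pi> \<in> pointed_partitions n" "(A, p) \<in> \<pi>" "(B, q) \<in> \<pi>" "Min A < Min B"
  shows "(A \<union> B, r) \<notin> \<pi>"
proof
  assume r: "(A \<union> B, r) \<in> \<pi>"
  have ne: "A \<noteq> {}" "B \<noteq> {}" and "(A, p) \<noteq> (B, q)" using pointed_partitionsD assms by auto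
  then have "A \<inter> B = {}" using pointed_partitions_disjoint assms by blast
  then have "(A, p) \<noteq> (A \<union> B, r)" using ne by auto
  then have "A \<inter> (A \<union> B) = {}" using pointed_partitions_disjoint[OF assms(1,2) r] by blast
  then show False using ne by auto
qed

lemma is_mergeE:
  assumes "is_merge l \<pi> \<pi>'"
  obtains A p B q u where "(A, p) \<in> \<pi>" "(B, q) \<in> \<pi>" "Min A < Min B" "u \<in> {0, 1}"
    "l = ((Min A, Min B), u)"
    "\<pi>' = insert (A \<union> B, if u = 1 then p else q) (\<pi> - {(A, p), (B, q)})"
  using assms unfolding is_merge_def by (elim exE conjE)

lemma is_mergeE':
  assumes "is_merge l \<pi> \<pi>'"
  obtains A p B q r where "(A, p) \<in> \<pi>" "(B, q) \<in> \<pi>" "Min A < Min B"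
    "\<pi>' = insert (A \<union> B, r) (\<pi> - {(A, p), (B, q)})" "r = p \<or> r = q"
proof (rule is_mergeE[OF assms])
  fix A p B q and u :: nat
  assume "(A, p) \<in> \<pi>" "(B, q) \<in> \<pi>" "Min A < Min B"
    "\<pi>' = insert (A \<union> B, if u = 1 then p else q) (\<pi> - {(A, p), (B, q)})"
  then show thesis using that[of A p B q "if u = 1 then p else q"] by simp
qed

lemma is_merge_card:
  assumes "\<pi> \<in> pointed_partitions n" "is_merge l \<pi> \<pi>'"
  shows "card \<pi> = Suc (card \<pi>')"
proof -
  obtain A p B q r where *: "(A, p) \<in> \<pi>" "(B, q) \<in> \<pi>" "Min A < Min B"
      "\<pi>' = insert (A \<union> B, r) (\<pi> - {(A, p), (B, q)})"
    using assms(2) by (rule is_mergeE')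
  have fin: "finite \<pi>" using finite_pointed_partition assms by blast
  have ne: "(A, p) \<noteq> (B, q)" using * by auto
  then have two: "card {(A, p), (B, q)} = 2" by (simp add: card_insert_if)
  have sub: "{(A, p), (B, q)} \<subseteq> \<pi>" using * by auto
  have "card (\<pi> - {(A, p), (B, q)}) = card \<pi> - 2" using card_Diff_subset[OF _ sub] two by simp
  moreover have "2 \<le> card \<pi>" using card_mono[OF fin sub] two by simp
  moreover have "(A \<union> B, r) \<notin> \<pi>" using merge_new_block assms * by blast
  ultimately show ?thesis using * fin by simp
qed

lemma is_merge_pointed_partitions:
  assumes "\<pi> \<in> pointed_partitions n" "is_merge l \<pi> \<pi>'"
  shows "\<pi>' \<in> pointed_partitions n"
proof -
  obtain A p B q r where *: "(A, p) \<in> \<pi>" "(B, q) \<in> \<pi>" "Min A < Min B"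
      "\<pi>' = insert (A \<union> B, r) (\<pi> - {(A, p), (B, q)})" "r = p \<or> r = q"
    using assms(2) by (rule is_mergeE')
  note AB = pointed_partitionsD[OF assms(1) *(1)] pointed_partitionsD[OF assms(1) *(2)]
  have dj: "X \<inter> Y = {}" if xy: "(X, x) \<in> \<pi>'" "(Y, y) \<in> \<pi>'" "(X, x) \<noteq> (Y, y)" for X x Y y
  proof -
    have old: "(A \<union> B) \<inter> Z = {}" if "(Z, z) \<in> \<pi> - {(A, p), (B, q)}" for Z z
      using that pointed_partitions_disjoint[OF assms(1) *(1), of Z z]
        pointed_partitions_disjoint[OF assms(1) *(2), of Z z] by blast
    consider "(X, x) \<in> \<pi>" "(Y, y) \<in> \<pi>" | "(X, x) = (A \<union> B, r)" "(Y, y) \<in> \<pi> - {(A, p), (B, q)}"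
      | "(X, x) \<in> \<pi> - {(A, p), (B, q)}" "(Y, y) = (A \<union> B, r)"
      using xy unfolding *(4) by auto
    then show ?thesis
      using old[of Y y] old[of X x] pointed_partitions_disjoint[OF assms(1) _ _ xy(3)]
      by cases blast+
  qed
  have el: "X \<noteq> {} \<and> finite X \<and> x \<in> X" if "(X, x) \<in> \<pi>'" for X x
    using that *(4,5) AB pointed_partitionsD[OF assms(1), of X x] by fastforce
  have un: "\<Union> (fst ` \<pi>) = {1..n}"
    using assms(1) by (auto simp: pointed_partitions_def partition_on_def)
  have "\<Union> (fst ` \<pi>') = A \<union> B \<union> \<Union> (fst ` (\<pi> - {(A, p), (B, q)}))" using * by auto
  also have "\<dots> = \<Union> (fst ` (insert (A, p) (insert (B, q) (\<pi> - {(A, p), (B, q)}))))" by auto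
  also have "insert (A, p) (insert (B, q) (\<pi> - {(A, p), (B, q)})) = \<pi>" using * by auto
  finally have "\<Union> (fst ` \<pi>') = {1..n}" using un by simp
  moreover have "inj_on fst \<pi>'"
    unfolding inj_on_def using dj el by (metis Int_absorb prod.collapse)
  moreover have "disjoint (fst ` \<pi>')"
    unfolding disjoint_def using dj by fastforce
  moreover have "{} \<notin> fst ` \<pi>'" using el by fastforce
  ultimately show ?thesis
    unfolding pointed_partitions_def partition_on_def using el by blast
qed

lemma merges_pointed_partitions:
  assumes "(\<lambda>\<sigma> \<tau>. \<exists>l. is_merge l \<sigma> \<tau>)\<^sup>*\<^sup>* \<pi> \<pi>'" "\<pi> \<in> pointed_partitions n"
  shows "\<pi>' \<in> pointed_partitions n \<and> card \<pi>' \<le> card \<pi> \<and> (card \<pi>' = card \<pi> \<longrightarrow> \<pi>' = \<pi>)"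
  using assms
proof (induction rule: rtranclp_induct)
  case (step y z)
  then obtain l where l: "is_merge l y z" and y: "y \<in> pointed_partitions n" "card y \<le> card \<pi>" by blast
  show ?case
    using is_merge_pointed_partitions[OF y(1) l] is_merge_card[OF y(1) l] y(2) by simp
qed simp

lemma pointed_partition_posetD:
  assumes "(\<pi>, \<pi>') \<in> pointed_partition_poset n"
  shows "\<pi> \<in> pointed_partitions n" "\<pi>' \<in> pointed_partitions n"
    "card \<pi>' \<le> card \<pi>" "card \<pi>' = card \<pi> \<Longrightarrow> \<pi>' = \<pi>"
  using assms merges_pointed_partitions[of \<pi> \<pi>' n] unfolding pointed_partition_poset_def by blast+

lemma pointed_partition_poset_refl:
  "\<pi> \<in> pointed_partitions n \<Longrightarrow> (\<pi>, \<pi>) \<in> pointed_partition_poset n"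
  by (simp add: pointed_partition_poset_def)

lemma Field_pointed_partition_poset: "Field (pointed_partition_poset n) = pointed_partitions n"
  using pointed_partition_posetD(1,2) pointed_partition_poset_refl unfolding Field_def by blast

lemma Partial_order_pointed_partition_poset: "Partial_order (pointed_partition_poset n)"
  unfolding Field_pointed_partition_poset partial_order_on_def preorder_on_def
proof (intro conjI)
  show "refl_on (pointed_partitions n) (pointed_partition_poset n)"
    using pointed_partition_poset_refl by (simp add: refl_on_def)
  show "pointed_partition_poset n \<subseteq> pointed_partitions n \<times> pointed_partitions n"
    by (auto dest: pointed_partition_posetD(1,2))
  show "trans (pointed_partition_poset n)"
    unfolding trans_def pointed_partition_poset_def using rtranclp_trans by fast
  show "antisym (pointed_partition_poset n)"
    unfolding antisym_def using pointed_partition_posetD(3,4) le_antisym by metis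
qed

lemma covers_pointed_partition_poset:
  "covers (pointed_partition_poset n) \<pi> \<pi>' \<longleftrightarrow>
     \<pi> \<in> pointed_partitions n \<and> (\<exists>l. is_merge l \<pi> \<pi>')"
proof
  assume c: "covers (pointed_partition_poset n) \<pi> \<pi>'"
  then have pi: "\<pi> \<in> pointed_partitions n" "\<pi> \<noteq> \<pi>'"
    and r: "(\<lambda>\<sigma> \<tau>. \<exists>l. is_merge l \<sigma> \<tau>)\<^sup>*\<^sup>* \<pi> \<pi>'"
    unfolding covers_def pointed_partition_poset_def by blast+
  obtain \<sigma> l where s: "is_merge l \<pi> \<sigma>" "(\<lambda>\<sigma> \<tau>. \<exists>l. is_merge l \<sigma> \<tau>)\<^sup>*\<^sup>* \<sigma> \<pi>'"
    by (rule converse_rtranclpE[OF r]) (use pi(2) in blast)+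
  then have "\<sigma> \<in> pointed_partitions n" "\<sigma> \<noteq> \<pi>"
    using is_merge_pointed_partitions[OF pi(1) s(1)] is_merge_card[OF pi(1) s(1)] by auto
  then have "\<sigma> = \<pi>'"
    using c s pi unfolding covers_def pointed_partition_poset_def by blast
  then show "\<pi> \<in> pointed_partitions n \<and> (\<exists>l. is_merge l \<pi> \<pi>')" using pi s by blast
next
  assume a: "\<pi> \<in> pointed_partitions n \<and> (\<exists>l. is_merge l \<pi> \<pi>')"
  then have cd: "card \<pi> = Suc (card \<pi>')" using is_merge_card by blast
  have "z = \<pi> \<or> z = \<pi>'"
    if "(\<pi>, z) \<in> pointed_partition_poset n" "(z, \<pi>') \<in> pointed_partition_poset n" for z
  proof -
    have "card z \<le> card \<pi> \<and> (card z = card \<pi> \<longrightarrow> z = \<pi>)"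
         "card \<pi>' \<le> card z \<and> (card \<pi>' = card z \<longrightarrow> \<pi>' = z)"
      using pointed_partition_posetD[OF that(1)] pointed_partition_posetD[OF that(2)] by auto
    moreover from this have "card z = card \<pi> \<or> card \<pi>' = card z" using cd by linarith
    ultimately show ?thesis by blast
  qed
  then show "covers (pointed_partition_poset n) \<pi> \<pi>'"
    using a cd unfolding covers_def pointed_partition_poset_def by auto
qed

lemma is_merge_label_unique:
  assumes pi: "\<pi> \<in> pointed_partitions n" and "is_merge l \<pi> \<pi>'" and "is_merge l' \<pi> \<pi>'"
  shows "l = l'"
proof -
  obtain A p B q u where 1: "(A, p) \<in> \<pi>" "(B, q) \<in> \<pi>" "Min A < Min B" "u \<in> {0, 1}"
      "l = ((Min A, Min B), u)" "\<pi>' = insert (A \<union> B, if u = 1 then p else q) (\<pi> - {(A, p), (B, q)})"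
    using assms(2) by (rule is_mergeE)
  obtain C r D s v where 2: "(C, r) \<in> \<pi>" "(D, s) \<in> \<pi>" "Min C < Min D" "v \<in> {0, 1}"
      "l' = ((Min C, Min D), v)" "\<pi>' = insert (C \<union> D, if v = 1 then r else s) (\<pi> - {(C, r), (D, s)})"
    using assms(3) by (rule is_mergeE)
  have n1: "(A \<union> B, x) \<notin> \<pi>" and n2: "(C \<union> D, x) \<notin> \<pi>" for x
    by (rule merge_new_block[OF pi 1(1-3)], rule merge_new_block[OF pi 2(1-3)])
  have d: "P - insert z (P - S) = S" "insert z (P - S) - P = {z}"
    if "S \<subseteq> P" "z \<notin> P" for P S and z :: pointed_set
    using that by auto
  have sub: "{(A, p), (B, q)} \<subseteq> \<pi>" "{(C, r), (D, s)} \<subseteq> \<pi>" using 1(1,2) 2(1,2) by simp_all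
  have "\<pi> - \<pi>' = {(A, p), (B, q)}" unfolding 1(6) by (rule d(1)[OF sub(1) n1])
  moreover have "\<pi> - \<pi>' = {(C, r), (D, s)}" unfolding 2(6) by (rule d(1)[OF sub(2) n2])
  ultimately have "{(A, p), (B, q)} = {(C, r), (D, s)}" by simp
  then have eq: "A = C" "p = r" "B = D" "q = s"
    using 1(3) 2(3) by (auto simp: doubleton_eq_iff)
  have "\<pi>' - \<pi> = {(A \<union> B, if u = 1 then p else q)}" unfolding 1(6) by (rule d(2)[OF sub(1) n1])
  moreover have "\<pi>' - \<pi> = {(C \<union> D, if v = 1 then r else s)}" unfolding 2(6) by (rule d(2)[OF sub(2) n2])
  ultimately have uv: "(if u = 1 then p else q) = (if v = 1 then p else q)"
    unfolding eq by simp
  have "(A, p) \<noteq> (B, q)" using 1(3) by auto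
  then have "p \<noteq> q"
    using pointed_partitions_disjoint[OF pi 1(1,2)] pointed_partitionsD[OF pi 1(1)]
      pointed_partitionsD[OF pi 1(2)] by auto
  then show ?thesis using uv eq 1(4,5) 2(4,5) by (auto split: if_splits)
qed

lemma pointed_labeling_eq:
  assumes "\<pi> \<in> pointed_partitions n" "is_merge l \<pi> \<pi>'"
  shows "pointed_labeling \<pi> \<pi>' = l"
  unfolding pointed_labeling_def using assms is_merge_label_unique by blast

lemma label_poset_iff:
  "(((a, b), u), ((c, d), v)) \<in> label_poset n \<longleftrightarrow>
     1 \<le> a \<and> a < b \<and> b \<le> n \<and> u \<in> {0, 1} \<and> 1 \<le> c \<and> c < d \<and> d \<le> n \<and> v \<in> {0, 1} \<and>
     (a < c \<or> a = c \<and> u < v \<or> a = c \<and> u = 0 \<and> v = 0 \<and> b = d \<or> a = c \<and> u = 1 \<and> v = 1 \<and> b \<le> d)"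
proof -
  let ?F = "\<lambda>m. foldr (\<lambda>a R. ordinal_sum (antichain_part n a) (ordinal_sum (chain_part n a) R)) [m..<n] {}"
  let ?L = "\<lambda>m. {((a, b), u) | a b u. m \<le> a \<and> a < b \<and> b \<le> n \<and> u \<in> {0, 1::nat}}"
  let ?R = "\<lambda>m. {(((a, b), u), ((c, d), v)) | a b u c d v.
     m \<le> a \<and> a < b \<and> b \<le> n \<and> u \<in> {0, 1::nat} \<and> m \<le> c \<and> c < d \<and> d \<le> n \<and> v \<in> {0, 1} \<and>
     (a < c \<or> a = c \<and> u < v \<or> a = c \<and> u = 0 \<and> v = 0 \<and> b = d \<or> a = c \<and> u = 1 \<and> v = 1 \<and> b \<le> d)}"
  have FR: "Field (?R m) = ?L m" for m
  proof
    show "Field (?R m) \<subseteq> ?L m" by (fastforce simp: Field_def)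
    show "?L m \<subseteq> Field (?R m)"
    proof
      fix x assume "x \<in> ?L m"
      then have "(x, x) \<in> ?R m" by auto
      then show "x \<in> Field (?R m)" by (rule FieldI1)
    qed
  qed
  have Fa: "Field (antichain_part n m) = {((m, b), 0) | b. m < b \<and> b \<le> n}" for m
    by (auto simp: antichain_part_def Field_def)
  have Fc: "Field (chain_part n m) = {((m, b), 1) | b. m < b \<and> b \<le> n}" for m
    by (fastforce simp: chain_part_def Field_def)
  have Fs: "Field (ordinal_sum R S) = Field R \<union> Field S" for R S :: "label rel"
    by (auto simp: ordinal_sum_def Field_def)
  have main: "?F m = ?R m" if "m \<le> n" for m
    using that
  proof (induction rule: inc_induct)
    case base
    show ?case by auto
  next
    case (step m)
    then have "?F m = ordinal_sum (antichain_part n m) (ordinal_sum (chain_part n m) (?R (Suc m)))"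
      by (simp add: upt_conv_Cons)
    also have "\<dots> = ?R m"
    proof (rule set_eqI)
      fix x :: "label \<times> label"
      obtain a b u c d v where x: "x = (((a, b), u), ((c, d), v))" by (metis prod.exhaust)
      have 1: "x \<in> ordinal_sum (antichain_part n m) (ordinal_sum (chain_part n m) (?R (Suc m))) \<longleftrightarrow>
        x \<in> antichain_part n m \<or> x \<in> chain_part n m \<or> x \<in> ?R (Suc m) \<or>
        x \<in> Field (chain_part n m) \<times> ?L (Suc m) \<or>
        x \<in> Field (antichain_part n m) \<times> (Field (chain_part n m) \<union> ?L (Suc m))"
        unfolding ordinal_sum_def[of "antichain_part n m"] Fs FR
        unfolding ordinal_sum_def FR by blast
      show "x \<in> ordinal_sum (antichain_part n m) (ordinal_sum (chain_part n m) (?R (Suc m))) \<longleftrightarrow>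
        x \<in> ?R m"
      proof -
        have A: "x \<in> antichain_part n m \<longleftrightarrow>
            a = m \<and> c = m \<and> b = d \<and> u = 0 \<and> v = 0 \<and> m < b \<and> b \<le> n"
          unfolding x antichain_part_def by auto
        have C: "x \<in> chain_part n m \<longleftrightarrow>
            a = m \<and> c = m \<and> u = 1 \<and> v = 1 \<and> m < b \<and> b \<le> d \<and> d \<le> n"
          unfolding x chain_part_def by auto
        have CL: "x \<in> Field (chain_part n m) \<times> ?L (Suc m) \<longleftrightarrow>
            a = m \<and> m < b \<and> b \<le> n \<and> u = 1 \<and> m < c \<and> c < d \<and> d \<le> n \<and> (v = 0 \<or> v = 1)"
          unfolding x Fc by auto
        have AL: "x \<in> Field (antichain_part n m) \<times> (Field (chain_part n m) \<union> ?L (Suc m)) \<longleftrightarrow>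
            a = m \<and> m < b \<and> b \<le> n \<and> u = 0 \<and>
            (c = m \<and> m < d \<and> d \<le> n \<and> v = 1 \<or> m < c \<and> c < d \<and> d \<le> n \<and> (v = 0 \<or> v = 1))"
          unfolding x Fa Fc by auto
        have R: "x \<in> ?R k \<longleftrightarrow> k \<le> a \<and> a < b \<and> b \<le> n \<and> (u = 0 \<or> u = 1) \<and>
            k \<le> c \<and> c < d \<and> d \<le> n \<and> (v = 0 \<or> v = 1) \<and> (a < c \<or> a = c \<and> u < v \<or>
            a = c \<and> u = 0 \<and> v = 0 \<and> b = d \<or> a = c \<and> u = 1 \<and> v = 1 \<and> b \<le> d)" for k
          unfolding x by simp
        show ?thesis
          unfolding 1 A C CL AL R
          by (cases "a = m"; cases "c = m"; cases "u = 0"; cases "v = 0"; cases "u = 1"; cases "v = 1")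
            (simp_all; linarith)+
      qed
    qed
    finally show ?case .
  qed
  show ?thesis
  proof (cases "n = 0")
    case True
    then show ?thesis by (simp add: label_poset_def)
  next
    case False
    then show ?thesis using main[of 1] by (simp add: label_poset_def)
  qed
qed

end

(* Going down from sigma towards rho, an edge splits a block C of sigma, with label (min C, b)^u. The
   largest label is obtained from the block C with the largest minimum that is not a block of rho, and
   it is obtained only once: split off the rho-block with the largest minimum among those in C that
   contain neither min C nor the point of C (u = 1), or, if there is none, cut C into the two rho-blocks
   that contain min C and the point of C (u = 0). After this split all labels of the next step are
   smaller; after any other split some label of the next step is not smaller. Hence the increasing chain
   of the dual labeling starts with this split, and induction over the interval finishes the proof. *)

theory Submission
  imports Defs "HOL-Library.Countable"
begin

section \<open>A criterion for EL-labelings\<close>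

text \<open>The obstacle is that a largest label must exist and have only one source. Labels with
  equal first entry and \<open>u = 0\<close> form an antichain, and one label may come from several
  splits, since the part of \<open>C\<close> that lacks the point \<open>c\<close> may take the
  point of any \<rho>-block inside it. Both troubles vanish at the top. If some block can be split
  off with \<open>u = 1\<close>, its label lies above the whole antichain, and a second part with
  the largest possible minimum has room for one block only, whose point is forced. Otherwise
  \<open>C\<close> consists of two blocks and has a single split. The antichain is also why other
  first steps are excluded by a next label that is merely not smaller: it may be incomparable. A
  condition on two consecutive labels suffices because the increasing chain of a shorter interval is
  lexicographically first there, so that its first label is minimal.\<close>

lemma maximal_chains_Cons:
  "x # z # r \<in> maximal_chains P x' y \<longleftrightarrow> x' = x \<and> covers P x z \<and> z # r \<in> maximal_chains P z y"
  by (auto simp: maximal_chains_def)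

lemma maximal_chains_singleton: "[x] \<in> maximal_chains P x' y \<longleftrightarrow> x' = x \<and> y = x"
  by (auto simp: maximal_chains_def)

lemma maximal_chainsE:
  assumes "c \<in> maximal_chains P x y"
  obtains "c = [x]" "x = y"
  | z r where "c = x # z # r" "covers P x z" "z # r \<in> maximal_chains P z y"
proof (cases c)
  case Nil
  then show ?thesis using assms by (simp add: maximal_chains_def)
next
  case (Cons a s)
  then show ?thesis
    using assms that by (cases s) (auto simp: maximal_chains_Cons maximal_chains_singleton)
qed

lemma label_sequence_singleton: "label_sequence lab [x] = []"
  by (simp add: label_sequence_def)

lemma label_sequence_Cons:
  "label_sequence lab (x # z # r) = lab x z # label_sequence lab (z # r)"
  by (simp add: label_sequence_def)

lemma increasing_chain_singleton: "increasing_chain \<Lambda> lab [x]"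
  by (simp add: increasing_chain_def label_sequence_singleton)

lemma increasing_chain_pair: "increasing_chain \<Lambda> lab [x, z]"
  by (simp add: increasing_chain_def label_sequence_def)

lemma increasing_chain_Cons:
  "increasing_chain \<Lambda> lab (x # z # w # r) \<longleftrightarrow>
    (lab x z, lab z w) \<in> \<Lambda> - Id \<and> increasing_chain \<Lambda> lab (z # w # r)"
  by (simp add: increasing_chain_def label_sequence_Cons)

lemma increasing_chain_tl:
  "increasing_chain \<Lambda> lab (x # z # r) \<Longrightarrow> increasing_chain \<Lambda> lab (z # r)"
  by (cases r) (auto simp: increasing_chain_Cons increasing_chain_singleton)

lemma lex_precedes_Cons:
  "lex_precedes \<Lambda> lab (x # z # r) (x # w # s) \<longleftrightarrow>
    (lab x z, lab x w) \<in> \<Lambda> - Id \<or> lab x z = lab x w \<and> lex_precedes \<Lambda> lab (z # r) (w # s)"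
  by (simp add: lex_precedes_def label_sequence_Cons)

text \<open>The list \<open>[x]\<close> is a maximal chain from \<open>x\<close> to \<open>x\<close>
  for any \<open>x\<close>, inside the poset or not; hence the assumption that \<open>x\<close> lies
  in the field.\<close>

lemma maximal_chain_le:
  assumes "trans P" "refl_on (Field P) P" "c \<in> maximal_chains P x y" "x \<in> Field P"
  shows "(x, y) \<in> P"
  using assms(3,4)
proof (induction c arbitrary: x)
  case Nil
  then show ?case by (simp add: maximal_chains_def)
next
  case (Cons a s)
  from Cons.prems(1) show ?case
  proof (cases rule: maximal_chainsE)
    case 1
    then show ?thesis using assms(2) Cons.prems(2) by (auto simp: refl_on_def)
  next
    case (2 z r)
    then have xz: "(x, z) \<in> P" by (simp add: covers_def)
    then have "(z, y) \<in> P" using Cons.IH[of z] 2 by (auto simp: Field_def)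
    then show ?thesis using xz assms(1) by (blast dest: transD)
  qed
qed

text \<open>The element \<open>z\<close> plays the role of the first atom of the increasing chain. The last condition
  excludes increasing chains starting with another atom \<open>z'\<close>: the second label of such a chain
  would be minimal among the labels of the atoms above \<open>z'\<close>.\<close>

lemma EL_labeling_atom_criterion:
  assumes P: "Partial_order P" "finite P" and L: "Partial_order \<Lambda>" "edge_labeling P \<Lambda> lab"
    and atom: "\<And>x y. (x, y) \<in> P \<Longrightarrow> x \<noteq> y \<Longrightarrow>
      \<exists>z. covers P x z \<and> (z, y) \<in> P \<and>
        (\<forall>w. covers P z w \<longrightarrow> (w, y) \<in> P \<longrightarrow> (lab x z, lab z w) \<in> \<Lambda> - Id) \<and>
        (\<forall>z'. covers P x z' \<longrightarrow> (z', y) \<in> P \<longrightarrow> z' \<noteq> z \<longrightarrow>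
          (lab x z, lab x z') \<in> \<Lambda> - Id \<and>
          (\<exists>w. covers P z' w \<and> (w, y) \<in> P \<and> (lab x z', lab z' w) \<notin> \<Lambda> - Id))"
  shows "EL_labeling P \<Lambda> lab"
proof -
  have trP: "trans P" and asP: "antisym P" and rfP: "refl_on (Field P) P"
    and trL: "trans \<Lambda>" and asL: "antisym \<Lambda>"
    using P L by (auto simp: partial_order_on_def preorder_on_def)
  have trL': "(a, c) \<in> \<Lambda> - Id" if "(a, b) \<in> \<Lambda> - Id" "(b, c) \<in> \<Lambda> - Id" for a b c
    using that trL asL by (auto dest: transD antisymD)
  have covP: "(a, b) \<in> P - Id" if "covers P a b" for a b using that by (auto simp: covers_def)
  \<comment> \<open>Induction along this relation keeps \<open>y\<close> fixed and assumes the claim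
    for every interval \<open>[z, y]\<close> with \<open>z\<close> strictly above \<open>x\<close>,
    not only for atoms \<open>z\<close>.\<close>
  have wf: "wf ((P - Id)\<inverse>)"
  proof (rule finite_acyclic_wf_converse)
    show "finite (P - Id)" using P by simp
    have "trans (P - Id)" using trP asP by (auto intro!: transI dest: transD antisymD)
    then show "acyclic (P - Id)" by (simp add: acyclic_irrefl irrefl_def)
  qed
  have le: "(z, y) \<in> P" if "c \<in> maximal_chains P z y" "covers P x z" for c x y z
    using maximal_chain_le[OF trP rfP that(1)] covP[OF that(2)] by (auto simp: Field_def)
  have main: "(\<exists>!c. c \<in> maximal_chains P x y \<and> increasing_chain \<Lambda> lab c) \<and>
        (\<forall>c \<in> maximal_chains P x y. increasing_chain \<Lambda> lab c \<longrightarrow>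
           (\<forall>d \<in> maximal_chains P x y. d \<noteq> c \<longrightarrow> lex_precedes \<Lambda> lab c d))"
    if "(x, y) \<in> P" for x y
    using that
  proof (induction x rule: wf_induct_rule[OF wf])
    case (1 x)
    have IH: "\<exists>!c. c \<in> maximal_chains P z y \<and> increasing_chain \<Lambda> lab c"
      and IHlex: "\<And>c d. c \<in> maximal_chains P z y \<Longrightarrow> increasing_chain \<Lambda> lab c \<Longrightarrow>
         d \<in> maximal_chains P z y \<Longrightarrow> d \<noteq> c \<Longrightarrow> lex_precedes \<Lambda> lab c d"
      if "(x, z) \<in> P - Id" "(z, y) \<in> P" for z
      using 1(1)[of z] that by blast+
    show ?case
    proof (cases "x = y")
      case True
      have only: "c = [x]" if c: "c \<in> maximal_chains P x x" for c
        using c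
      proof (cases rule: maximal_chainsE)
        case (2 z r)
        then show ?thesis using antisymD[OF asP, of x z] le[of "z # r" z x x] covP[of x z] by simp
      qed simp
      have "[x] \<in> maximal_chains P x x \<and> increasing_chain \<Lambda> lab [x]"
        by (simp add: maximal_chains_singleton increasing_chain_singleton)
      then have "\<exists>!c. c \<in> maximal_chains P x x \<and> increasing_chain \<Lambda> lab c"
        by (rule ex1I) (use only in blast)
      moreover have "c = d" if "c \<in> maximal_chains P x x" "d \<in> maximal_chains P x x" for c d
        using only[OF that(1)] only[OF that(2)] by simp
      ultimately show ?thesis unfolding True[symmetric] by blast
    next
      case False
      obtain z where z: "covers P x z" "(z, y) \<in> P"
        and z2: "\<forall>w. covers P z w \<longrightarrow> (w, y) \<in> P \<longrightarrow> (lab x z, lab z w) \<in> \<Lambda> - Id"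
        and z13: "\<forall>z'. covers P x z' \<longrightarrow> (z', y) \<in> P \<longrightarrow> z' \<noteq> z \<longrightarrow>
          (lab x z, lab x z') \<in> \<Lambda> - Id \<and>
          (\<exists>w. covers P z' w \<and> (w, y) \<in> P \<and> (lab x z', lab z' w) \<notin> \<Lambda> - Id)"
        using atom[OF 1(2) False] by (elim exE conjE)
      note z1 = z13[rule_format, THEN conjunct1] and z3 = z13[rule_format, THEN conjunct2]
      obtain c where c: "c \<in> maximal_chains P z y" "increasing_chain \<Lambda> lab c"
        using IH[OF covP[OF z(1)] z(2)] by blast
      have c_hd: "\<exists>r. c = z # r" using c(1) by (cases rule: maximal_chainsE) auto
      have xc: "x # c \<in> maximal_chains P x y"
        using c(1) c_hd z(1) by (auto simp: maximal_chains_Cons)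
      have incr: "increasing_chain \<Lambda> lab (x # c)"
        using c(1)
      proof (cases rule: maximal_chainsE)
        case (2 w r)
        then have "(w, y) \<in> P" using le by blast
        then show ?thesis using z2 2 c(2) by (simp add: increasing_chain_Cons)
      qed (simp add: increasing_chain_pair)
      have unique: "d = x # c" if d: "d \<in> maximal_chains P x y" "increasing_chain \<Lambda> lab d" for d
        using d(1)
      proof (cases rule: maximal_chainsE)
        case 1
        then show ?thesis using False by simp
      next
        case (2 z' r)
        have z'y: "(z', y) \<in> P" using le 2 by blast
        have inc: "increasing_chain \<Lambda> lab (z' # r)"
          using increasing_chain_tl d(2) unfolding 2(1) .
        have "z' = z"
        proof (rule ccontr)
          assume "z' \<noteq> z"
          obtain w where w: "covers P z' w" "(w, y) \<in> P" "(lab x z', lab z' w) \<notin> \<Lambda> - Id"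
            using z3[OF 2(2) z'y \<open>z' \<noteq> z\<close>] by (elim exE conjE)
          \<comment> \<open>The induction hypothesis at \<open>w\<close> is needed only for the
            existence of some chain up to \<open>y\<close>, which completes \<open>z'\<close>,
            \<open>w\<close> to a competitor of \<open>z' # r\<close>.\<close>
          have xw: "(x, w) \<in> P - Id"
            using covP[OF 2(2)] covP[OF w(1)] transD[OF trP, of x z' w] antisymD[OF asP, of x z']
            by auto
          obtain e where e: "e \<in> maximal_chains P w y" using IH[OF xw w(2)] by blast
          have "\<exists>s. e = w # s" using e by (cases rule: maximal_chainsE) auto
          then obtain s where s: "e = w # s" by blast
          have e': "z' # w # s \<in> maximal_chains P z' y"
            using e w(1) s by (simp add: maximal_chains_Cons)
          from 2(3) show False
          proof (cases rule: maximal_chainsE)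
            case 1
            then show False using antisymD[OF asP, of w y] covP[OF w(1)] w(2) by simp
          next
            case (2 v t)
            then have r: "r = v # t" by simp
            have lt: "(lab x z', lab z' v) \<in> \<Lambda> - Id"
              using d(2) \<open>d = x # z' # r\<close> r by (simp add: increasing_chain_Cons)
            \<comment> \<open>The increasing chain of \<open>[z', y]\<close> precedes the competitor
              through \<open>w\<close>, so its first label is at most \<open>lab z' w\<close>. An
              ascent into \<open>v\<close> would then also be an ascent into
              \<open>w\<close>.\<close>
            have "z' # v # t = z' # w # s \<or> lex_precedes \<Lambda> lab (z' # v # t) (z' # w # s)"
              using IHlex[OF covP[OF \<open>covers P x z'\<close>] z'y _ inc e'] r
                \<open>z' # r \<in> maximal_chains P z' y\<close> by auto
            then have "lab z' v = lab z' w \<or> (lab z' v, lab z' w) \<in> \<Lambda> - Id"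
              by (auto simp: lex_precedes_Cons)
            then show False using lt w(3) trL' by metis
          qed
        qed
        then have "z' # r = c"
          using IH[OF covP[OF z(1)] z(2)] c inc 2(3) unfolding ex1_iff_ex_Uniq Uniq_def by simp
        then show ?thesis using 2(1) by simp
      qed
      have lex: "lex_precedes \<Lambda> lab (x # c) d" if d: "d \<in> maximal_chains P x y" "d \<noteq> x # c" for d
        using d(1)
      proof (cases rule: maximal_chainsE)
        case 1
        then show ?thesis using False by simp
      next
        case (2 z' r)
        obtain s where s: "c = z # s" using c_hd by blast
        show ?thesis
        proof (cases "z' = z")
          case True
          then have "lex_precedes \<Lambda> lab c (z # r)"
            using IHlex[OF covP[OF z(1)] z(2) c, of "z # r"] 2 d(2) by simp
          then show ?thesis using True 2(1) s by (simp add: lex_precedes_Cons)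
        next
          case False
          then show ?thesis
            using z1[OF 2(2) le[OF 2(3,2)]] s unfolding 2(1) by (simp add: lex_precedes_Cons)
        qed
      qed
      have "\<exists>!c. c \<in> maximal_chains P x y \<and> increasing_chain \<Lambda> lab c"
        by (rule ex1I[of _ "x # c"]) (use xc incr unique in blast)+
      then show ?thesis using unique lex by blast
    qed
  qed
  show ?thesis unfolding EL_labeling_def using P L main by blast
qed

section \<open>Intervals and relabeling\<close>

lemma Field_Restr_closed_interval:
  assumes "Partial_order P"
  shows "Field (Restr P (closed_interval P a b)) = closed_interval P a b"
proof -
  have "refl_on (Field P) P" using assms by (auto simp: partial_order_on_def preorder_on_def)
  then have "(z, z) \<in> Restr P (closed_interval P a b)" if "z \<in> closed_interval P a b" for z
    using that by (auto simp: closed_interval_def refl_on_def Field_def)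
  then show ?thesis by (auto simp: Field_def)
qed

text \<open>Intervals are convex: whatever lies between two elements of the interval survives the
  restriction.\<close>

lemma covers_Restr_closed_interval:
  assumes "trans P" "x \<in> closed_interval P a b" "y \<in> closed_interval P a b"
  shows "covers (Restr P (closed_interval P a b)) x y \<longleftrightarrow> covers P x y"
proof -
  have "z \<in> closed_interval P a b" if "(x, z) \<in> P" "(z, y) \<in> P" for z
    using assms that unfolding closed_interval_def by (auto dest: transD)
  then show ?thesis using assms unfolding covers_def by blast
qed

lemma maximal_chains_Restr_closed_interval:
  assumes "Partial_order P" "x \<in> closed_interval P a b" "y \<in> closed_interval P a b"
  shows "maximal_chains (Restr P (closed_interval P a b)) x y = maximal_chains P x y"
proof -
  let ?I = "closed_interval P a b"
  have tr: "trans P" and rf: "refl_on (Field P) P"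
    using assms(1) by (auto simp: partial_order_on_def preorder_on_def)
  have "c \<in> maximal_chains (Restr P ?I) x y \<longleftrightarrow> c \<in> maximal_chains P x y" for c
    using assms(2)
  proof (induction c arbitrary: x)
    case Nil
    then show ?case by (simp add: maximal_chains_def)
  next
    case (Cons u s)
    show ?case
    proof (cases s)
      case Nil
      then show ?thesis by (simp add: maximal_chains_singleton)
    next
      case (Cons z r)
      have "z \<in> ?I" if "covers P x z" "z # r \<in> maximal_chains P z y"
      proof -
        have xz: "(x, z) \<in> P" using that(1) by (simp add: covers_def)
        then have "(z, y) \<in> P" using maximal_chain_le[OF tr rf that(2)] by (auto simp: Field_def)
        then show ?thesis
          using xz assms(3) \<open>x \<in> ?I\<close> tr unfolding closed_interval_def by (auto dest: transD)
      qed
      moreover have "z \<in> ?I" if "covers (Restr P ?I) x z"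
        using that by (auto simp: covers_def)
      ultimately show ?thesis
        using Cons.IH[of z] covers_Restr_closed_interval[OF tr \<open>x \<in> ?I\<close>, of z]
        unfolding Cons by (auto simp: maximal_chains_Cons)
    qed
  qed
  then show ?thesis by blast
qed

lemma EL_labeling_Restr_closed_interval:
  assumes "EL_labeling P \<Lambda> lab"
  shows "EL_labeling (Restr P (closed_interval P a b)) \<Lambda> lab"
proof -
  let ?I = "closed_interval P a b"
  have P: "Partial_order P" and L: "Partial_order \<Lambda>" "edge_labeling P \<Lambda> lab"
    using assms by (auto simp: EL_labeling_def)
  have tr: "trans P" using P by (auto simp: partial_order_on_def preorder_on_def)
  have "Partial_order (Restr P ?I)" using P by (rule Partial_order_Restr)
  moreover have "edge_labeling (Restr P ?I) \<Lambda> lab"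
    unfolding edge_labeling_def
  proof (intro allI impI)
    fix x y assume *: "covers (Restr P ?I) x y"
    then have "x \<in> ?I" "y \<in> ?I" by (auto simp: covers_def)
    then have "covers P x y" using * covers_Restr_closed_interval[OF tr] by blast
    then show "lab x y \<in> Field \<Lambda>" using L by (simp add: edge_labeling_def)
  qed
  moreover have "maximal_chains (Restr P ?I) x y = maximal_chains P x y" and "(x, y) \<in> P"
    if "(x, y) \<in> Restr P ?I" for x y
    using that maximal_chains_Restr_closed_interval[OF P] by auto
  ultimately show ?thesis
    using assms unfolding EL_labeling_def by (metis (lifting))
qed

section \<open>Renaming labels along an injection\<close>

lemma label_sequence_comp: "label_sequence (\<lambda>x y. f (lab x y)) c = map f (label_sequence lab c)"
  by (auto simp: label_sequence_def zip_map2 zip_map1 split: prod.splits intro: list.map_cong)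

lemma lexord_map:
  assumes "\<And>a b. (f a, f b) \<in> S \<longleftrightarrow> (a, b) \<in> R" "inj f"
  shows "(map f xs, map f ys) \<in> lexord S \<longleftrightarrow> (xs, ys) \<in> lexord R"
proof (induction xs arbitrary: ys)
  case Nil
  then show ?case by (cases ys) auto
next
  case (Cons x xs)
  then show ?case using assms by (cases ys) (auto dest: injD)
qed

text \<open>On the image relation \<open>f\<close> is an order embedding, and injectivity keeps
  strict relations strict. Thus ascents and lexicographic comparisons are the same before and after
  renaming.\<close>

lemma EL_labeling_relabel:
  fixes f :: "'l \<Rightarrow> 'm"
  assumes "EL_labeling P \<Lambda> lab" "inj f"
  shows "EL_labeling P (map_prod f f ` \<Lambda>) (\<lambda>x y. f (lab x y))"
proof -
  let ?M = "map_prod f f ` \<Lambda>"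
  have M: "(f a, f b) \<in> ?M \<longleftrightarrow> (a, b) \<in> \<Lambda>" for a b
    using assms(2) by (auto dest: injD)
  then have M': "(f a, f b) \<in> ?M - Id \<longleftrightarrow> (a, b) \<in> \<Lambda> - Id" for a b
    using assms(2) by (auto dest: injD)
  have F: "Field ?M = f ` Field \<Lambda>" by (force simp: Field_def)
  have PL: "Partial_order P" "Partial_order \<Lambda>" "edge_labeling P \<Lambda> lab"
    using assms by (auto simp: EL_labeling_def)
  have L: "refl_on (Field \<Lambda>) \<Lambda>" "trans \<Lambda>" "antisym \<Lambda>"
    using PL(2) by (auto simp: partial_order_on_def preorder_on_def)
  have dom: "\<exists>a b. x = f a \<and> y = f b" if "(x, y) \<in> ?M" for x y using that by auto
  have "Partial_order ?M"
    unfolding partial_order_on_def preorder_on_def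
  proof (intro conjI)
    show "refl_on (Field ?M) ?M"
      using L(1) M unfolding F by (auto simp only: refl_on_def)
    show "?M \<subseteq> Field ?M \<times> Field ?M" by (auto intro: FieldI1 FieldI2)
    show "trans ?M"
    proof (rule transI)
      fix x y z assume xyz: "(x, y) \<in> ?M" "(y, z) \<in> ?M"
      obtain a b c where "x = f a" "y = f b" "z = f c" using dom[OF xyz(1)] dom[OF xyz(2)] by blast
      then show "(x, z) \<in> ?M" using xyz L(2) by (simp only: M) (blast dest: transD)
    qed
    show "antisym ?M"
    proof (rule antisymI)
      fix x y assume xy: "(x, y) \<in> ?M" "(y, x) \<in> ?M"
      obtain a b where "x = f a" "y = f b" using dom[OF xy(1)] by blast
      then show "x = y" using xy L(3) by (simp only: M) (blast dest: antisymD)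
    qed
  qed
  moreover have "edge_labeling P ?M (\<lambda>x y. f (lab x y))"
    using PL(3) by (auto simp: edge_labeling_def F)
  moreover have "increasing_chain ?M (\<lambda>x y. f (lab x y)) c \<longleftrightarrow> increasing_chain \<Lambda> lab c" for c
    using M' by (simp add: increasing_chain_def label_sequence_comp successively_map)
  moreover have "lex_precedes ?M (\<lambda>x y. f (lab x y)) c d \<longleftrightarrow> lex_precedes \<Lambda> lab c d" for c d
    unfolding lex_precedes_def label_sequence_comp using lexord_map[OF M' assms(2)] .
  ultimately show ?thesis using assms(1) PL(1) unfolding EL_labeling_def by simp
qed

text \<open>\<open>EL_shellable\<close> asks for labels in \<open>nat\<close>, and
  \<open>to_nat\<close> embeds a countable label type there. The ends \<open>a\<close> and
  \<open>b\<close> are the required bottom and top.\<close>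

lemma EL_shellable_closed_interval:
  fixes \<Lambda> :: "'l::countable rel"
  assumes "EL_labeling P \<Lambda> lab" "finite P" "(a, b) \<in> P"
  shows "EL_shellable (Restr P (closed_interval P a b))"
proof -
  let ?I = "closed_interval P a b"
  have P: "Partial_order P" using assms by (simp add: EL_labeling_def)
  then have "refl_on (Field P) P" by (auto simp: partial_order_on_def preorder_on_def)
  then have ab: "a \<in> ?I" "b \<in> ?I"
    using assms(3) by (auto simp: closed_interval_def refl_on_def Field_def)
  have "finite (Field (Restr P ?I))" using assms(2) by (simp add: finite_Field)
  moreover have "EL_labeling (Restr P ?I) (map_prod to_nat to_nat ` \<Lambda>) (\<lambda>x y. to_nat (lab x y))"
    using EL_labeling_relabel[OF EL_labeling_Restr_closed_interval[OF assms(1)] inj_to_nat] .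
  moreover have "\<forall>x \<in> ?I. (a, x) \<in> Restr P ?I \<and> (x, b) \<in> Restr P ?I"
    using ab by (auto simp: closed_interval_def)
  ultimately show ?thesis
    using ab Partial_order_Restr[OF P, of ?I] Field_Restr_closed_interval[OF P, of a b]
    unfolding EL_shellable_def by metis
qed

section \<open>Splitting a block\<close>

text \<open>A pointed set \<open>C\<^sup>c\<close> can be a block of an element above \<open>\<rho>\<close> exactly if it is saturated.\<close>

definition saturated :: "pointed_set set \<Rightarrow> nat set \<Rightarrow> nat \<Rightarrow> bool" where
  "saturated \<rho> C c \<longleftrightarrow> C \<subseteq> \<Union> (fst ` \<rho>) \<and> (\<forall>(B, b) \<in> \<rho>. B \<subseteq> C \<or> B \<inter> C = {}) \<and> c \<in> C \<and> c \<in> snd ` \<rho>"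

text \<open>A merge read backwards on one block; \<open>c = d\<close> is the case
  \<open>u = 1\<close>. The point of the part without \<open>c\<close> is constrained only by
  saturation, so one division of \<open>C\<close> may give several splits.\<close>

definition block_split ::
  "pointed_set set \<Rightarrow> nat set \<Rightarrow> nat \<Rightarrow> nat set \<Rightarrow> nat \<Rightarrow> nat set \<Rightarrow> nat \<Rightarrow> bool" where
  "block_split \<rho> C c D d E e \<longleftrightarrow> saturated \<rho> D d \<and> saturated \<rho> E e \<and>
     D \<union> E = C \<and> D \<inter> E = {} \<and> Min D < Min E \<and> (c = d \<or> c = e)"

definition split_label :: "nat \<Rightarrow> nat set \<Rightarrow> nat \<Rightarrow> nat set \<Rightarrow> label" where
  "split_label c D d E = ((Min D, Min E), if c = d then 1 else 0)"

text \<open>The strict order of \<open>label_poset n\<close> freed from the bound \<open>n\<close>;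
  \<open>strict_label_poset_iff\<close> relates the two.\<close>

fun label_less :: "label \<Rightarrow> label \<Rightarrow> bool" where
  "label_less ((a, b), u) ((c, d), v) \<longleftrightarrow> a < c \<or> a = c \<and> (u < v \<or> u = 1 \<and> v = 1 \<and> b < d)"

section \<open>Saturated sets and the \<rho>-blocks inside them\<close>

lemma pointed_partitions_Union: "\<pi> \<in> pointed_partitions n \<Longrightarrow> \<Union> (fst ` \<pi>) = {1..n}"
  by (simp add: pointed_partitions_def partition_on_def)

lemma saturated_finite:
  assumes "\<rho> \<in> pointed_partitions n" "saturated \<rho> C c"
  shows "finite C" "C \<noteq> {}" "C \<subseteq> {1..n}" "Min C \<in> C"
proof -
  show *: "C \<subseteq> {1..n}" "C \<noteq> {}"
    using assms pointed_partitions_Union[OF assms(1)] unfolding saturated_def by auto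
  then show "finite C" using finite_subset by blast
  then show "Min C \<in> C" using * by simp
qed

lemma saturated_block:
  assumes "saturated \<rho> C c" "x \<in> C"
  obtains B b where "(B, b) \<in> \<rho>" "x \<in> B" "B \<subseteq> C"
proof -
  have "x \<in> \<Union> (fst ` \<rho>)" using assms unfolding saturated_def by blast
  then obtain B b where B: "(B, b) \<in> \<rho>" "x \<in> B" by auto
  then have "B \<subseteq> C" using assms unfolding saturated_def by blast
  then show ?thesis using that B by blast
qed

lemma same_block:
  assumes "\<rho> \<in> pointed_partitions n" "(A, a) \<in> \<rho>" "(B, b) \<in> \<rho>" "x \<in> A" "x \<in> B"
  shows "A = B" "a = b"
proof -
  have "(A, a) = (B, b)" using pointed_partitions_disjoint[OF assms(1-3)] assms(4,5) by blast
  then show "A = B" "a = b" by simp_all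
qed

lemma saturated_pointed_block:
  assumes "\<rho> \<in> pointed_partitions n" "(B, b) \<in> \<rho>"
  shows "saturated \<rho> B b"
proof -
  have "A \<subseteq> B \<or> A \<inter> B = {}" if "(A, a) \<in> \<rho>" for A a
    using same_block(1)[OF assms(1) that assms(2)] by blast
  moreover have "B \<in> fst ` \<rho>" "b \<in> snd ` \<rho>" using assms(2) by force+
  ultimately show ?thesis
    using pointed_partitionsD(3)[OF assms] unfolding saturated_def by blast
qed

text \<open>The \<rho>-block with point \<open>c\<close> contains \<open>c\<close> and so meets
  \<open>C\<close>; blocks of \<rho> that meet coincide together with their points.\<close>

lemma saturated_block_point:
  assumes "\<rho> \<in> pointed_partitions n" "saturated \<rho> C c" "(C, b) \<in> \<rho>"
  shows "b = c"
proof -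
  obtain B where B: "(B, c) \<in> \<rho>" using assms(2) unfolding saturated_def by auto
  moreover have "c \<in> C" using assms(2) by (simp add: saturated_def)
  ultimately show ?thesis
    using same_block[OF assms(1,3) B] pointed_partitionsD(3)[OF assms(1) B] by blast
qed

lemma saturated_Un:
  assumes "saturated \<rho> D d" "saturated \<rho> E e" "c = d \<or> c = e"
  shows "saturated \<rho> (D \<union> E) c"
proof -
  have "B \<subseteq> D \<union> E \<or> B \<inter> (D \<union> E) = {}" if "(B, b) \<in> \<rho>" for B b
  proof -
    have "B \<subseteq> D \<or> B \<inter> D = {}" "B \<subseteq> E \<or> B \<inter> E = {}"
      using assms(1,2) that unfolding saturated_def by blast+
    then show ?thesis by blast
  qed
  moreover have "D \<union> E \<subseteq> \<Union> (fst ` \<rho>)" "c \<in> D \<union> E" "c \<in> snd ` \<rho>"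
    using assms by (auto simp: saturated_def)
  ultimately show ?thesis unfolding saturated_def by blast
qed

section \<open>Splits of a single block\<close>

lemma block_split_saturated: "block_split \<rho> C c D d E e \<Longrightarrow> saturated \<rho> C c"
  unfolding block_split_def using saturated_Un by blast

lemma block_split_Min:
  assumes "\<rho> \<in> pointed_partitions n" "block_split \<rho> C c D d E e"
  shows "Min D = Min C"
proof -
  have *: "saturated \<rho> D d" "saturated \<rho> E e" "C = D \<union> E" "Min D < Min E"
    using assms(2) by (auto simp: block_split_def)
  note D = saturated_finite[OF assms(1) *(1)] and E = saturated_finite[OF assms(1) *(2)]
  show "Min D = Min C" using Min_Un[OF D(1,2) E(1,2)] *(3,4) by simp
qed

lemma block_split_point:
  assumes "block_split \<rho> C c D d E e"
  shows "c \<noteq> d \<longleftrightarrow> c \<in> E" "c = d \<longleftrightarrow> c \<in> D"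
  using assms by (auto simp: block_split_def saturated_def)

text \<open>A block of \<rho> equal to \<open>C\<close> would meet both saturated parts and hence
  lie in each of them, although they are disjoint.\<close>

lemma no_block_split:
  assumes "block_split \<rho> C c D d E e"
  shows "C \<notin> fst ` \<rho>"
proof
  assume "C \<in> fst ` \<rho>"
  then obtain b where C: "(C, b) \<in> \<rho>" by auto
  have s: "saturated \<rho> D d" "saturated \<rho> E e" "C = D \<union> E" "D \<inter> E = {}" "d \<in> D" "e \<in> E"
    using assms by (auto simp: block_split_def saturated_def)
  have "C \<subseteq> D \<or> C \<inter> D = {}" "C \<subseteq> E \<or> C \<inter> E = {}"
    using s(1,2) C unfolding saturated_def by blast+
  then show False using s by blast
qed

text \<open>The remainder keeps the minimum of \<open>C\<close>, so it is the first part, and it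
  keeps the point \<open>c\<close>, so the label has \<open>u = 1\<close>.\<close>

lemma split_off_block:
  assumes rho: "\<rho> \<in> pointed_partitions n" and "saturated \<rho> C c"
    and B: "(B, b) \<in> \<rho>" "B \<subseteq> C" "c \<notin> B" "Min C \<notin> B"
  shows "block_split \<rho> C c (C - B) c B b"
proof -
  note C = saturated_finite[OF assms(1,2)]
  have "A \<subseteq> C - B \<or> A \<inter> (C - B) = {}" if "(A, a) \<in> \<rho>" for A a
    using same_block(1)[OF rho that B(1)] assms(2) that unfolding saturated_def by blast
  then have s: "saturated \<rho> (C - B) c"
    using assms(2) B(3) unfolding saturated_def by blast
  have "Min (C - B) = Min C" using C B(4) by (intro Min_eqI) auto
  moreover have "Min B \<in> B" using pointed_partitionsD[OF rho B(1)] by simp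
  then have "Min C < Min B" using B(2,4) C Min_le[OF C(1), of "Min B"] by fastforce
  ultimately show ?thesis
    using s saturated_pointed_block[OF rho B(1)] B(2) by (auto simp: block_split_def)
qed

text \<open>Only the block of \<open>Min C\<close> and the block of \<open>c\<close> can occur in
  \<open>C\<close>, and they differ because \<open>C\<close> is not a block itself. The point lies
  in the second part, so the label has \<open>u = 0\<close>.\<close>

lemma two_block_split:
  assumes rho: "\<rho> \<in> pointed_partitions n" and sat: "saturated \<rho> C c" and "C \<notin> fst ` \<rho>"
    and none: "\<And>B b. (B, b) \<in> \<rho> \<Longrightarrow> B \<subseteq> C \<Longrightarrow> c \<in> B \<or> Min C \<in> B"
  obtains A a B where "(A, a) \<in> \<rho>" "(B, c) \<in> \<rho>" "block_split \<rho> C c A a B c"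
proof -
  note C = saturated_finite[OF rho sat]
  obtain A a where A: "(A, a) \<in> \<rho>" "Min C \<in> A" "A \<subseteq> C" using saturated_block[OF sat C(4)] by blast
  obtain B where B: "(B, c) \<in> \<rho>" using sat by (auto simp: saturated_def)
  have cB: "c \<in> B" using pointed_partitionsD(3)[OF rho B] .
  have BC: "B \<subseteq> C" using sat B cB unfolding saturated_def by blast
  have un: "C = A \<union> B"
  proof
    show "C \<subseteq> A \<union> B"
    proof
      fix x assume "x \<in> C"
      then obtain X b where X: "(X, b) \<in> \<rho>" "x \<in> X" "X \<subseteq> C" using saturated_block[OF sat] by blast
      then show "x \<in> A \<union> B"
        using none[OF X(1,3)] same_block(1)[OF rho X(1) A(1)] same_block(1)[OF rho X(1) B] A(2) cB
        by blast
    qed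
  qed (use A BC in blast)
  have ne: "A \<noteq> B"
  proof
    assume "A = B"
    then have "C = A" using un by simp
    then show False using A(1) assms(3) by force
  qed
  then have dj: "A \<inter> B = {}" using same_block(1)[OF rho A(1) B] by blast
  have "Min A = Min C" using A C finite_subset[OF A(3) C(1)] by (intro Min_eqI) auto
  moreover have "Min B \<in> B" using pointed_partitionsD[OF rho B] by simp
  then have "Min C < Min B"
    using BC A(2) dj C Min_le[OF C(1), of "Min B"] by (metis IntI emptyE le_neq_implies_less subsetD)
  ultimately have "block_split \<rho> C c A a B c"
    using saturated_pointed_block[OF rho A(1)] saturated_pointed_block[OF rho B] un dj
    by (simp add: block_split_def)
  then show ?thesis using that A(1) B by blast
qed

lemma ex_block_split:
  assumes "\<rho> \<in> pointed_partitions n" "saturated \<rho> C c" "C \<notin> fst ` \<rho>"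
  shows "\<exists>D d E e. block_split \<rho> C c D d E e"
proof (cases "\<exists>B b. (B, b) \<in> \<rho> \<and> B \<subseteq> C \<and> c \<notin> B \<and> Min C \<notin> B")
  case True
  then show ?thesis using split_off_block[OF assms(1,2)] by blast
next
  case False
  show ?thesis by (rule two_block_split[OF assms]) (use False in blast)+
qed

text \<open>A second part that is a block of \<rho> forces \<open>e\<close>. The point
  \<open>d\<close> is \<open>c\<close> itself if \<open>u = 1\<close>; if \<open>u = 0\<close> it is
  forced only when \<open>D\<close> is a block of \<rho>, which explains the last
  assumption.\<close>

lemma block_split_by_block:
  assumes rho: "\<rho> \<in> pointed_partitions n"
    and "block_split \<rho> C c D d B e" "(B, b) \<in> \<rho>" "block_split \<rho> C c D' d' B e'"
    and "c = d \<longleftrightarrow> c = d'" "D \<in> fst ` \<rho> \<or> c = d"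
  shows "D' = D" "d' = d" "e' = e"
proof -
  have s: "saturated \<rho> D d" "saturated \<rho> D' d'" "saturated \<rho> B e" "saturated \<rho> B e'"
    using assms(2,4) by (auto simp: block_split_def)
  show "e' = e"
    using saturated_block_point[OF rho s(3) assms(3)] saturated_block_point[OF rho s(4) assms(3)]
    by simp
  show D: "D' = D" using assms(2,4) unfolding block_split_def by blast
  show "d' = d"
  proof (cases "c = d")
    case True
    then show ?thesis using assms(5) by simp
  next
    case False
    then obtain a where "(D, a) \<in> \<rho>" using assms(6) by auto
    then show ?thesis
      using saturated_block_point[OF rho s(1)] saturated_block_point[OF rho s(2)] D by auto
  qed
qed

text \<open>The split of a block with the largest label: if possible, split off the block with the largest
  minimum among those containing neither the minimum nor the point of \<open>C\<close>.\<close>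

lemma top_block_split:
  assumes rho: "\<rho> \<in> pointed_partitions n" and sat: "saturated \<rho> C c" and nt: "C \<notin> fst ` \<rho>"
  shows "\<exists>D d E e. block_split \<rho> C c D d E e \<and> E \<in> fst ` \<rho> \<and>
    (\<forall>D' d' E' e'. block_split \<rho> C c D' d' E' e' \<longrightarrow> (D', d', E', e') \<noteq> (D, d, E, e) \<longrightarrow>
       label_less (split_label c D' d' E') (split_label c D d E)) \<and>
    (\<forall>D' d' E' e'. block_split \<rho> D d D' d' E' e' \<longrightarrow>
       label_less (split_label d D' d' E') (split_label c D d E)) \<and>
    (\<forall>D' d' E' e'. block_split \<rho> C c D' d' E' e' \<longrightarrow> (D', d', E', e') \<noteq> (D, d, E, e) \<longrightarrow>
       E' \<in> fst ` \<rho> \<longrightarrow> (\<exists>D'' d'' E'' e''. block_split \<rho> D' d' D'' d'' E'' e'' \<and>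
         \<not> label_less (split_label d' D'' d'' E'') (split_label c D' d' E')))"
proof -
  \<comment> \<open>A split of \<open>C\<close> with \<open>u = 1\<close> exists exactly if
    \<open>T\<close> is nonempty: any member can be split off, and conversely every block inside the
    second part of such a split belongs to \<open>T\<close>.\<close>
  define T where "T = {(B, b) \<in> \<rho>. B \<subseteq> C \<and> c \<notin> B \<and> Min C \<notin> B}"
  show ?thesis
  proof (cases "T = {}")
    case True
    obtain A a B where AB: "(A, a) \<in> \<rho>" "(B, c) \<in> \<rho>" "block_split \<rho> C c A a B c"
      by (rule two_block_split[OF rho sat nt]) (use True in \<open>auto simp: T_def\<close>)
    have A0: "A \<in> fst ` \<rho>" and B0: "B \<in> fst ` \<rho>" using AB by force+
    \<comment> \<open>\<open>A\<close> must go to the part with the minimum, which leaves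
      \<open>B\<close> for the other part, and points of blocks are forced. As \<open>A\<close>
      cannot be split either, the claims about other splits and about the next step become
      vacuous.\<close>
    have uniq: "(D, d, E, e) = (A, a, B, c)" if D: "block_split \<rho> C c D d E e" for D d E e
    proof -
      have C: "C = A \<union> B" "C = D \<union> E" "D \<inter> E = {}"
        using AB(3) D unfolding block_split_def by auto
      have "Min C \<in> A" "Min C \<in> D"
        using block_split_Min[OF rho AB(3)] block_split_Min[OF rho D]
          saturated_finite(4)[OF rho] AB(3) D unfolding block_split_def by metis+
      then have "A \<subseteq> D" using AB(1) D unfolding block_split_def saturated_def by blast
      moreover have "B \<subseteq> E"
      proof -
        have "e \<in> E" "saturated \<rho> E e" using D by (auto simp: block_split_def saturated_def)
        then have "e \<in> B" using C \<open>A \<subseteq> D\<close> by blast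
        then show ?thesis using \<open>e \<in> E\<close> \<open>saturated \<rho> E e\<close> AB(2) unfolding saturated_def by blast
      qed
      ultimately have "D = A" "E = B" using C AB(3) unfolding block_split_def by blast+
      moreover have "a = d" "c = e"
        using D saturated_block_point[OF rho _ AB(1)] saturated_block_point[OF rho _ AB(2)]
          \<open>D = A\<close> \<open>E = B\<close> by (auto simp: block_split_def)
      ultimately show ?thesis by simp
    qed
    have "\<not> block_split \<rho> A a D d E e" for D d E e using no_block_split A0 by blast
    then show ?thesis using AB(3) B0 uniq by (metis (no_types, lifting))
  next
    case False
    have "finite T" using finite_pointed_partition[OF rho] by (auto simp: T_def intro: finite_subset)
    then obtain P where P: "P \<in> T" "\<And>Q. Q \<in> T \<Longrightarrow> Min (fst Q) \<le> Min (fst P)"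
      using False Max_in[of "(\<lambda>Q. Min (fst Q)) ` T"] Max_ge[of "(\<lambda>Q. Min (fst Q)) ` T"] by fastforce
    obtain B b where "P = (B, b)" by (cases P)
    then have BT: "(B, b) \<in> T" and max: "\<And>A a. (A, a) \<in> T \<Longrightarrow> Min A \<le> Min B" using P by force+
    have B: "(B, b) \<in> \<rho>" "B \<subseteq> C" "c \<notin> B" "Min C \<notin> B" using BT by (auto simp: T_def)
    have B0: "B \<in> fst ` \<rho>" using B by force
    have MinB: "Min A \<in> A" if "(A, a) \<in> \<rho>" for A a using pointed_partitionsD[OF rho that] by simp
    have split: "block_split \<rho> C c (C - B) c B b" using split_off_block[OF rho sat B] .
    have MC: "Min C \<in> C" using saturated_finite[OF rho sat] by simp
    have Min_eq: "A = B" if "(A, a) \<in> \<rho>" "Min A = Min B" for A a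
      using same_block(1)[OF rho that(1) B(1)] MinB[OF that(1)] MinB[OF B(1)] that(2) by simp
    \<comment> \<open>\<open>X\<close> will be \<open>C\<close>, for the splits competing with the
      top one, or \<open>C - B\<close>, for the splits of the next step; both have the same
      minimum.\<close>
    have inT: "(A, a) \<in> T" if "block_split \<rho> X c D' d' E' e'" "X \<subseteq> C" "Min X = Min C" "c = d'"
      "(A, a) \<in> \<rho>" "A \<subseteq> E'" for X D' d' E' e' A a
    proof -
      have "Min X \<in> D'"
        using block_split_Min[OF rho that(1)] saturated_finite(4)[OF rho, of D' d'] that(1)
        by (simp add: block_split_def)
      moreover have "c \<in> D'" "E' \<subseteq> C" "D' \<inter> E' = {}"
        using that(1,2,4) by (auto simp: block_split_def saturated_def)
      ultimately show ?thesis using that(3,5,6) unfolding T_def by auto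
    qed
    have MinE: "\<exists>A a. (A, a) \<in> T \<and> A \<subseteq> E' \<and> Min A = Min E'"
      if "block_split \<rho> X c D' d' E' e'" "X \<subseteq> C" "Min X = Min C" "c = d'" for X D' d' E' e'
    proof -
      have E': "saturated \<rho> E' e'" using that(1) by (simp add: block_split_def)
      note fin = saturated_finite[OF rho E']
      obtain A a where A: "(A, a) \<in> \<rho>" "Min E' \<in> A" "A \<subseteq> E'" using saturated_block[OF E' fin(4)] .
      have "Min A = Min E'" using A fin finite_subset[OF A(3) fin(1)] by (intro Min_eqI) auto
      then show ?thesis using A inT[OF that A(1,3)] by blast
    qed
    show ?thesis
    proof (rule exI[of _ "C - B"], rule exI[of _ c], rule exI[of _ B], rule exI[of _ b],
        intro conjI allI impI split B0)
      fix D' d' E' e'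
      assume D': "block_split \<rho> C c D' d' E' e'" and ne: "(D', d', E', e') \<noteq> (C - B, c, B, b)"
      have mD: "Min D' = Min C" using block_split_Min[OF rho D'] by simp
      show "label_less (split_label c D' d' E') (split_label c (C - B) c B)"
      proof (cases "c = d'")
        \<comment> \<open>With \<open>u = 0\<close> the label lies in the antichain below the chain
          that contains the top label.\<close>
        case False
        then show ?thesis using mD block_split_Min[OF rho split] by (simp add: split_label_def)
      next
        case True
        obtain A a where A: "(A, a) \<in> T" "A \<subseteq> E'" "Min A = Min E'"
          using MinE[OF D' _ _ True] by blast
        have "Min E' \<noteq> Min B"
        proof
          assume eq: "Min E' = Min B"
          have E': "saturated \<rho> E' e'" using D' by (simp add: block_split_def)
          \<comment> \<open>Every block inside \<open>E'\<close> belongs to \<open>T\<close>, so its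
            minimum is at most \<open>Min B\<close>; it is also at least \<open>Min E'\<close>,
            which equals \<open>Min B\<close> here. So the block is \<open>B\<close>, and no larger
            \<open>E'\<close> can share the top label.\<close>
          have "x \<in> B" if xE: "x \<in> E'" for x
          proof -
            obtain X y where X: "(X, y) \<in> \<rho>" "x \<in> X" "X \<subseteq> E'" using saturated_block[OF E' xE] .
            have "Min X \<le> Min B" using max inT[OF D' _ _ True X(1,3)] by blast
            moreover have "Min E' \<le> Min X"
              using MinB[OF X(1)] X(3) saturated_finite(1)[OF rho E'] by (auto intro: Min_le)
            ultimately have "Min X = Min B" using eq by simp
            then have "X = B" by (rule Min_eq[OF X(1)])
            then show ?thesis using X(2) by simp
          qed
          moreover have "A = B"
          proof (rule Min_eq)
            show "(A, a) \<in> \<rho>" using A(1) by (simp add: T_def)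
            show "Min A = Min B" using A(3) eq by simp
          qed
          ultimately have eqB: "E' = B" using A(2) by blast
          show False
            using block_split_by_block[OF rho split B(1) D'[unfolded eqB]] True ne eqB by blast
        qed
        then have "Min E' < Min B" using max[OF A(1)] A(3) by simp
        then show ?thesis
          using True mD block_split_Min[OF rho split] by (simp add: split_label_def)
      qed
    next
      fix D' d' E' e'
      assume D': "block_split \<rho> (C - B) c D' d' E' e'"
      have mC: "Min (C - B) = Min C" using block_split_Min[OF rho split] .
      have mD: "Min D' = Min (C - B)" using block_split_Min[OF rho D'] by simp
      show "label_less (split_label c D' d' E') (split_label c (C - B) c B)"
      proof (cases "c = d'")
        case False
        then show ?thesis using mD by (simp add: split_label_def)
      next
        case True
        obtain A a where A: "(A, a) \<in> T" "A \<subseteq> E'" "Min A = Min E'"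
          using MinE[OF D' _ mC True] by blast
        \<comment> \<open>\<open>B\<close> is no longer available, so the member of \<open>T\<close>
          that supplies \<open>Min E'\<close> has a smaller minimum.\<close>
        have "E' \<inter> B = {}" using D' unfolding block_split_def by blast
        then have "A \<noteq> B" using A(2) MinB[OF B(1)] by blast
        moreover have "(A, a) \<in> \<rho>" using A(1) by (simp add: T_def)
        ultimately have "Min A \<noteq> Min B" using Min_eq by blast
        then have "Min E' < Min B" using max[OF A(1)] A(3) by simp
        then show ?thesis using True mD by (simp add: split_label_def)
      qed
    next
      fix D' d' E' e'
      assume D': "block_split \<rho> C c D' d' E' e'" and ne: "(D', d', E', e') \<noteq> (C - B, c, B, b)"
        and E': "E' \<in> fst ` \<rho>"
      have mD: "Min D' = Min C" using block_split_Min[OF rho D'] by simp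
      have sD: "saturated \<rho> D' d'" using D' by (simp add: block_split_def)
      obtain a where a: "(E', a) \<in> \<rho>" using E' by auto
      have "E' \<noteq> B"
      proof
        assume eq: "E' = B"
        then have "c = d'" using block_split_point[OF D'] B(3) by blast
        then show False
          using block_split_by_block[OF rho split B(1) D'[unfolded eq]] ne eq by blast
      qed
      then have "B \<inter> E' = {}" using same_block(1)[OF rho B(1) a] by blast
      then have BD: "B \<subseteq> D'" using B(2) D' unfolding block_split_def by blast
      show "\<exists>D'' d'' E'' e''. block_split \<rho> D' d' D'' d'' E'' e'' \<and>
         \<not> label_less (split_label d' D'' d'' E'') (split_label c D' d' E')"
      proof (cases "c = d'")
        \<comment> \<open>\<open>B\<close> can still be split off from \<open>D'\<close>, and its
          minimum is at least \<open>Min E'\<close>.\<close>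
        case True
        have s: "block_split \<rho> D' c (D' - B) c B b"
          using split_off_block[OF rho _ B(1) BD B(3)] sD True B(4) mD by simp
        have "(E', a) \<in> T" using inT[OF D' _ _ True a] by simp
        then have "Min E' \<le> Min B" by (rule max)
        then have "\<not> label_less (split_label c (D' - B) c B) (split_label c D' c E')"
          using block_split_Min[OF rho s] by (simp add: split_label_def)
        then show ?thesis using s True by blast
      next
        \<comment> \<open>No label with first entry \<open>Min C\<close> lies strictly below one
          with \<open>u = 0\<close>, so any split of \<open>D'\<close> will do. One exists because
          \<open>D'\<close> contains \<open>B\<close> and also \<open>Min C\<close>, which is not in
          \<open>B\<close>.\<close>
        case False
        have "D' \<notin> fst ` \<rho>"
        proof
          assume "D' \<in> fst ` \<rho>"
          then obtain x where "(D', x) \<in> \<rho>" by auto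
          then have "D' = B" using same_block(1)[OF rho _ B(1)] MinB[OF B(1)] BD by blast
          then show False using B(4) mD saturated_finite(4)[OF rho sD] by simp
        qed
        then obtain D'' d'' E'' e'' where s: "block_split \<rho> D' d' D'' d'' E'' e''"
          using ex_block_split[OF rho sD] by blast
        have "\<not> label_less (split_label d' D'' d'' E'') (split_label c D' d' E')"
          using False block_split_Min[OF rho s] by (simp add: split_label_def)
        then show ?thesis using s by blast
      qed
    qed
  qed
qed

section \<open>Splitting a pointed partition\<close>

definition finer :: "pointed_set set \<Rightarrow> pointed_set set \<Rightarrow> bool" where
  "finer \<rho> \<sigma> \<longleftrightarrow> (\<forall>(C, c) \<in> \<sigma>. saturated \<rho> C c)"

definition replace_block ::
  "pointed_set set \<Rightarrow> nat set \<Rightarrow> nat \<Rightarrow> nat set \<Rightarrow> nat \<Rightarrow> nat set \<Rightarrow> nat \<Rightarrow> pointed_set set" where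
  "replace_block \<sigma> C c D d E e = insert (D, d) (insert (E, e) (\<sigma> - {(C, c)}))"

lemma finerD: "finer \<rho> \<sigma> \<Longrightarrow> (C, c) \<in> \<sigma> \<Longrightarrow> saturated \<rho> C c"
  by (auto simp: finer_def)

lemma finer_refl: "\<rho> \<in> pointed_partitions n \<Longrightarrow> finer \<rho> \<rho>"
  using saturated_pointed_block by (auto simp: finer_def)

text \<open>Disjointness is demanded for distinct pairs, which also rules out one set with two
  points: it would be disjoint from itself.\<close>

lemma pointed_partitionsI:
  assumes "\<And>A p. (A, p) \<in> \<pi> \<Longrightarrow> p \<in> A" "\<Union> (fst ` \<pi>) = {1..n}"
    and dj: "\<And>A p B q. (A, p) \<in> \<pi> \<Longrightarrow> (B, q) \<in> \<pi> \<Longrightarrow> (A, p) \<noteq> (B, q) \<Longrightarrow> A \<inter> B = {}"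
  shows "\<pi> \<in> pointed_partitions n"
proof -
  have "A \<noteq> {} \<and> finite A \<and> p \<in> A" if "(A, p) \<in> \<pi>" for A p
  proof -
    have "A \<subseteq> {1..n}" unfolding assms(2)[symmetric] using that by force
    then show ?thesis using finite_subset assms(1)[OF that] by blast
  qed
  moreover from this have "{} \<notin> fst ` \<pi>" by fastforce
  moreover have "inj_on fst \<pi>"
  proof (rule inj_onI)
    fix x y assume xy: "x \<in> \<pi>" "y \<in> \<pi>" "fst x = fst y"
    obtain A p q where [simp]: "x = (A, p)" "y = (A, q)" using xy(3) by (metis prod.collapse)
    have "p \<in> A" using assms(1) xy(1) by simp
    then show "x = y" using dj[of A p A q] xy by auto
  qed
  moreover have "disjoint (fst ` \<pi>)"
  proof (rule disjointI)
    fix A B assume "A \<in> fst ` \<pi>" "B \<in> fst ` \<pi>" and ne: "A \<noteq> B"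
    then obtain p q where "(A, p) \<in> \<pi>" "(B, q) \<in> \<pi>" by (metis imageE prod.collapse)
    then show "A \<inter> B = {}" using dj ne by blast
  qed
  ultimately show ?thesis
    using assms(2) unfolding pointed_partitions_def partition_on_def by blast
qed

lemma replace_block:
  assumes rho: "\<rho> \<in> pointed_partitions n" and sigma: "\<sigma> \<in> pointed_partitions n" "finer \<rho> \<sigma>"
    and C: "(C, c) \<in> \<sigma>" and split: "block_split \<rho> C c D d E e"
  shows "replace_block \<sigma> C c D d E e \<in> pointed_partitions n"
    and "finer \<rho> (replace_block \<sigma> C c D d E e)"
    and "is_merge (split_label c D d E) (replace_block \<sigma> C c D d E e) \<sigma>"
proof -
  let ?\<tau> = "replace_block \<sigma> C c D d E e"
  have s: "saturated \<rho> D d" "saturated \<rho> E e" "D \<union> E = C" "D \<inter> E = {}" "Min D < Min E"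
    "c = d \<or> c = e" "d \<in> D" "e \<in> E" "d \<noteq> e"
    using split by (auto simp: block_split_def saturated_def)
  show "finer \<rho> ?\<tau>"
    using sigma(2) s(1,2) by (auto simp: finer_def replace_block_def)
  have old: "X \<inter> C = {}" if "(X, x) \<in> \<sigma> - {(C, c)}" for X x
    using pointed_partitions_disjoint[OF sigma(1) _ C, of X x] that by blast
  have mem: "(X, x) = (D, d) \<or> (X, x) = (E, e) \<or> (X, x) \<in> \<sigma> - {(C, c)}" if "(X, x) \<in> ?\<tau>" for X x
    using that unfolding replace_block_def by blast
  show "?\<tau> \<in> pointed_partitions n"
  proof (rule pointed_partitionsI)
    fix X x assume "(X, x) \<in> ?\<tau>"
    then show "x \<in> X" using mem[of X x] s(7,8) pointed_partitionsD(3)[OF sigma(1), of X x] by auto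
  next
    have "\<Union> (fst ` ?\<tau>) = \<Union> (fst ` insert (C, c) (\<sigma> - {(C, c)}))"
      using s(3) by (auto simp: replace_block_def)
    also have "\<dots> = {1..n}"
      using pointed_partitions_Union[OF sigma(1)] C by (simp only: insert_Diff)
    finally show "\<Union> (fst ` ?\<tau>) = {1..n}" .
  next
    fix X x Y y assume xy: "(X, x) \<in> ?\<tau>" "(Y, y) \<in> ?\<tau>" "(X, x) \<noteq> (Y, y)"
    have "X \<inter> Y = {}" if "(X, x) \<in> \<sigma> - {(C, c)}" "(Y, y) \<in> \<sigma> - {(C, c)}"
      using pointed_partitions_disjoint[OF sigma(1) _ _ xy(3)] that by blast
    then show "X \<inter> Y = {}"
      using mem[OF xy(1)] mem[OF xy(2)] xy(3) old[of X x] old[of Y y] s(3,4) by blast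
  qed
  have "(D, d) \<notin> \<sigma> - {(C, c)}" "(E, e) \<notin> \<sigma> - {(C, c)}" using old s(3,7,8) by blast+
  then have "?\<tau> - {(D, d), (E, e)} = \<sigma> - {(C, c)}" by (auto simp: replace_block_def)
  then have "\<sigma> = insert (D \<union> E, c) (?\<tau> - {(D, d), (E, e)})" using C s(3) by auto
  moreover have "(if (if c = d then 1 else (0::nat)) = 1 then d else e) = c" using s(6) by auto
  ultimately show "is_merge (split_label c D d E) ?\<tau> \<sigma>"
    unfolding is_merge_def split_label_def using s(5)
    by (intro exI[of _ D] exI[of _ d] exI[of _ E] exI[of _ e] exI[of _ "if c = d then 1 else (0::nat)"])
      (simp add: replace_block_def)
qed

text \<open>Disjoint blocks have different points, so \<open>u\<close> can be read off by comparing
  the point of the merged block with that of the first part, as \<open>split_label\<close>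
  does.\<close>

lemma is_merge_replace_block:
  assumes tau: "\<tau> \<in> pointed_partitions n" "finer \<rho> \<tau>" and "is_merge l \<tau> \<sigma>"
  obtains C c D d E e where "(C, c) \<in> \<sigma>" "block_split \<rho> C c D d E e"
    "\<tau> = replace_block \<sigma> C c D d E e" "l = split_label c D d E"
proof -
  obtain A p B q u where m: "(A, p) \<in> \<tau>" "(B, q) \<in> \<tau>" "Min A < Min B" "u \<in> {0, 1}"
      "l = ((Min A, Min B), u)"
      "\<sigma> = insert (A \<union> B, if u = 1 then p else q) (\<tau> - {(A, p), (B, q)})"
    using assms(3) by (rule is_mergeE)
  define r where "r = (if u = 1 then p else q)"
  have "(A, p) \<noteq> (B, q)" using m(3) by auto
  then have dj: "A \<inter> B = {}" using pointed_partitions_disjoint[OF tau(1) m(1,2)] by blast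
  then have "p \<noteq> q"
    using pointed_partitionsD(3)[OF tau(1) m(1)] pointed_partitionsD(3)[OF tau(1) m(2)] by auto
  then have "l = split_label r A p B" using m(4,5) by (auto simp: split_label_def r_def)
  moreover have "block_split \<rho> (A \<union> B) r A p B q"
    using finerD[OF tau(2) m(1)] finerD[OF tau(2) m(2)] m(3) dj
    by (auto simp: block_split_def r_def)
  moreover have "(A \<union> B, r) \<notin> \<tau>" by (rule merge_new_block[OF tau(1) m(1-3)])
  then have "\<tau> = replace_block \<sigma> (A \<union> B) r A p B q"
    using m(1,2) unfolding m(6) replace_block_def r_def[symmetric] by auto
  moreover have "(A \<union> B, r) \<in> \<sigma>" unfolding m(6) r_def by simp
  ultimately show thesis using that by blast
qed

lemma finer_merge:
  assumes "\<tau> \<in> pointed_partitions n" "finer \<rho> \<tau>" "is_merge l \<tau> \<sigma>"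
  shows "finer \<rho> \<sigma>"
proof -
  obtain C c D d E e where C: "block_split \<rho> C c D d E e" "\<tau> = replace_block \<sigma> C c D d E e"
    using is_merge_replace_block[OF assms] by metis
  have "saturated \<rho> X x" if "(X, x) \<in> \<sigma>" for X x
    using block_split_saturated[OF C(1)] finerD[OF assms(2), of X x] that
    unfolding C(2) replace_block_def by blast
  then show ?thesis by (auto simp: finer_def)
qed

text \<open>If every block of \<sigma> had the underlying set of a block of \<rho>, saturation would
  make the points agree as well; since both cover \<open>{1..n}\<close>, the two partitions would be
  equal.\<close>

lemma ex_nontrivial_block:
  assumes rho: "\<rho> \<in> pointed_partitions n" and sigma: "\<sigma> \<in> pointed_partitions n" "finer \<rho> \<sigma>"
    and "\<sigma> \<noteq> \<rho>"
  shows "\<exists>(C, c) \<in> \<sigma>. C \<notin> fst ` \<rho>"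
proof (rule ccontr)
  assume "\<not> ?thesis"
  then have triv: "\<exists>b. (C, b) \<in> \<rho>" if "(C, c) \<in> \<sigma>" for C c using that by force
  have sub: "(C, c) \<in> \<rho>" if C: "(C, c) \<in> \<sigma>" for C c
  proof -
    obtain b where b: "(C, b) \<in> \<rho>" using triv[OF C] ..
    then show ?thesis using saturated_block_point[OF rho finerD[OF sigma(2) C] b] by simp
  qed
  have "(B, b) \<in> \<sigma>" if B: "(B, b) \<in> \<rho>" for B b
  proof -
    have "b \<in> \<Union> (fst ` \<sigma>)"
      using pointed_partitionsD(3,4)[OF rho B] pointed_partitions_Union[OF sigma(1)] by auto
    then obtain C c where C: "(C, c) \<in> \<sigma>" "b \<in> C" by auto
    then show ?thesis
      using same_block[OF rho B sub[OF C(1)] pointed_partitionsD(3)[OF rho B]] by simp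
  qed
  then show False using sub assms(4) by auto
qed

lemma finite_pointed_partitions: "finite (pointed_partitions n)"
proof (rule finite_subset)
  show "pointed_partitions n \<subseteq> Pow (Pow {1..n} \<times> {1..n})"
    using pointed_partitionsD(3,4) by fastforce
qed simp

text \<open>Reachability by merges becomes a condition on each block of \<sigma> separately, which
  allows a single block to be split without regard to the others.\<close>

lemma pointed_partition_poset_iff:
  "(\<rho>, \<sigma>) \<in> pointed_partition_poset n \<longleftrightarrow>
    \<rho> \<in> pointed_partitions n \<and> \<sigma> \<in> pointed_partitions n \<and> finer \<rho> \<sigma>"
proof
  assume le: "(\<rho>, \<sigma>) \<in> pointed_partition_poset n"
  then have rho: "\<rho> \<in> pointed_partitions n"
    and "(\<lambda>\<sigma> \<tau>. \<exists>l. is_merge l \<sigma> \<tau>)\<^sup>*\<^sup>* \<rho> \<sigma>"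
    by (auto simp: pointed_partition_poset_def)
  from this(2) have "\<sigma> \<in> pointed_partitions n \<and> finer \<rho> \<sigma>"
  proof (induction rule: rtranclp_induct)
    case base
    then show ?case using rho finer_refl by blast
  next
    case (step y z)
    then show ?case using finer_merge is_merge_pointed_partitions by blast
  qed
  then show "\<rho> \<in> pointed_partitions n \<and> \<sigma> \<in> pointed_partitions n \<and> finer \<rho> \<sigma>"
    using rho by blast
next
  \<comment> \<open>Each split adds a block, so the distance of the number of blocks from this bound
    decreases.\<close>
  let ?K = "Max (card ` pointed_partitions n)"
  assume "\<rho> \<in> pointed_partitions n \<and> \<sigma> \<in> pointed_partitions n \<and> finer \<rho> \<sigma>"
  then have rho: "\<rho> \<in> pointed_partitions n"
    and "\<sigma> \<in> pointed_partitions n" "finer \<rho> \<sigma>" by auto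
  from this(2,3) have "(\<lambda>\<sigma> \<tau>. \<exists>l. is_merge l \<sigma> \<tau>)\<^sup>*\<^sup>* \<rho> \<sigma>"
  proof (induction "?K - card \<sigma>" arbitrary: \<sigma> rule: less_induct)
    case less
    show ?case
    proof (cases "\<sigma> = \<rho>")
      case False
      obtain C c where C: "(C, c) \<in> \<sigma>" "C \<notin> fst ` \<rho>"
        using ex_nontrivial_block[OF rho less.prems False] by blast
      obtain D d E e where s: "block_split \<rho> C c D d E e"
        using ex_block_split[OF rho finerD[OF less.prems(2) C(1)] C(2)] by blast
      define \<tau> where "\<tau> = replace_block \<sigma> C c D d E e"
      note tau = replace_block[OF rho less.prems C(1) s, folded \<tau>_def]
      have "card \<tau> \<le> ?K" using finite_pointed_partitions tau(1) by simp
      then have "?K - card \<tau> < ?K - card \<sigma>" using is_merge_card[OF tau(1,3)] by simp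
      then have "(\<lambda>\<sigma> \<tau>. \<exists>l. is_merge l \<sigma> \<tau>)\<^sup>*\<^sup>* \<rho> \<tau>" using less.hyps tau by blast
      then show ?thesis using tau(3) by (blast intro: rtranclp.rtrancl_into_rtrancl)
    qed simp
  qed
  then show "(\<rho>, \<sigma>) \<in> pointed_partition_poset n"
    using rho by (simp add: pointed_partition_poset_def)
qed

section \<open>Edges of the dual poset as block splits\<close>

lemma covers_converse: "covers (P\<inverse>) x y \<longleftrightarrow> covers P y x"
  unfolding covers_def by blast

lemma dual_atomI:
  assumes le: "(\<sigma>, \<rho>) \<in> (pointed_partition_poset n)\<inverse>"
    and C: "(C, c) \<in> \<sigma>" and split: "block_split \<rho> C c D d E e"
  defines "\<tau> \<equiv> replace_block \<sigma> C c D d E e"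
  shows "covers ((pointed_partition_poset n)\<inverse>) \<sigma> \<tau>" "(\<tau>, \<rho>) \<in> (pointed_partition_poset n)\<inverse>"
    "dual_labeling pointed_labeling \<sigma> \<tau> = split_label c D d E"
proof -
  have rho: "\<rho> \<in> pointed_partitions n" and sigma: "\<sigma> \<in> pointed_partitions n" "finer \<rho> \<sigma>"
    using le by (auto simp: pointed_partition_poset_iff)
  note tau = replace_block[OF rho sigma C split, folded \<tau>_def]
  show "covers ((pointed_partition_poset n)\<inverse>) \<sigma> \<tau>"
    unfolding covers_converse covers_pointed_partition_poset using tau by blast
  show "(\<tau>, \<rho>) \<in> (pointed_partition_poset n)\<inverse>"
    using tau rho by (simp add: pointed_partition_poset_iff)
  show "dual_labeling pointed_labeling \<sigma> \<tau> = split_label c D d E"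
    unfolding dual_labeling_def using pointed_labeling_eq[OF tau(1,3)] .
qed

lemma dual_atomE:
  assumes "covers ((pointed_partition_poset n)\<inverse>) \<sigma> \<tau>" "(\<tau>, \<rho>) \<in> (pointed_partition_poset n)\<inverse>"
  obtains C c D d E e where "(C, c) \<in> \<sigma>" "block_split \<rho> C c D d E e"
    "\<tau> = replace_block \<sigma> C c D d E e" "dual_labeling pointed_labeling \<sigma> \<tau> = split_label c D d E"
proof -
  obtain l where tau: "\<tau> \<in> pointed_partitions n" "is_merge l \<tau> \<sigma>"
    using assms(1) unfolding covers_converse covers_pointed_partition_poset by blast
  have "finer \<rho> \<tau>" using assms(2) by (simp add: pointed_partition_poset_iff)
  then obtain C c D d E e where "(C, c) \<in> \<sigma>" "block_split \<rho> C c D d E e"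
      "\<tau> = replace_block \<sigma> C c D d E e" "l = split_label c D d E"
    using is_merge_replace_block[OF tau(1) _ tau(2)] by metis
  then show thesis
    using that pointed_labeling_eq[OF tau] by (simp add: dual_labeling_def)
qed

section \<open>The label poset\<close>

lemma refl_label_poset_iff:
  "(((a, b), u), ((a, b), u)) \<in> label_poset n \<longleftrightarrow> 1 \<le> a \<and> a < b \<and> b \<le> n \<and> u \<in> {0, 1}"
  unfolding label_poset_iff by auto

lemma label_poset_refl: "(x, y) \<in> label_poset n \<Longrightarrow> (x, x) \<in> label_poset n \<and> (y, y) \<in> label_poset n"
  by (cases x; cases y) (auto simp: label_poset_iff)

lemma Field_label_poset: "x \<in> Field (label_poset n) \<longleftrightarrow> (x, x) \<in> label_poset n"
  using label_poset_refl unfolding Field_def by blast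

lemma Partial_order_label_poset: "Partial_order (label_poset n)"
  unfolding partial_order_on_def preorder_on_def
proof (intro conjI)
  show "refl_on (Field (label_poset n)) (label_poset n)"
    by (simp add: refl_on_def Field_label_poset)
  show "label_poset n \<subseteq> Field (label_poset n) \<times> Field (label_poset n)"
    by (auto intro: FieldI1 FieldI2)
  show "trans (label_poset n)"
  proof (rule transI)
    fix x y z :: label assume "(x, y) \<in> label_poset n" "(y, z) \<in> label_poset n"
    then show "(x, z) \<in> label_poset n"
      by (cases x; cases y; cases z) (auto simp: label_poset_iff)
  qed
  show "antisym (label_poset n)"
  proof (rule antisymI)
    fix x y :: label assume "(x, y) \<in> label_poset n" "(y, x) \<in> label_poset n"
    then show "x = y" by (cases x; cases y) (auto simp: label_poset_iff)
  qed
qed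

text \<open>Because the label order is reversed too, an ascent of the dual labeling is a descent for
  \<open>label_less\<close>.\<close>

lemma strict_label_poset_iff:
  assumes "l \<in> Field (label_poset n)" "l' \<in> Field (label_poset n)"
  shows "(l, l') \<in> (label_poset n)\<inverse> - Id \<longleftrightarrow> label_less l' l"
  using assms unfolding Field_label_poset by (cases l; cases l') (auto simp: label_poset_iff)

lemma split_label_Field:
  assumes "\<rho> \<in> pointed_partitions n" "block_split \<rho> C c D d E e"
  shows "split_label c D d E \<in> Field (label_poset n)"
proof -
  have s: "saturated \<rho> D d" "saturated \<rho> E e" "Min D < Min E"
    using assms(2) by (auto simp: block_split_def)
  have "Min D \<in> {1..n}" "Min E \<in> {1..n}"
    using saturated_finite(3,4)[OF assms(1) s(1)] saturated_finite(3,4)[OF assms(1) s(2)] by blast+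
  then show ?thesis
    using s(3) by (simp add: Field_label_poset split_label_def refl_label_poset_iff)
qed

section \<open>The dual labeling\<close>

lemma dual_edge_labeling:
  "edge_labeling ((pointed_partition_poset n)\<inverse>) ((label_poset n)\<inverse>) (dual_labeling pointed_labeling)"
  unfolding edge_labeling_def
proof (intro allI impI)
  fix \<sigma> \<tau> assume c: "covers ((pointed_partition_poset n)\<inverse>) \<sigma> \<tau>"
  then have tau: "\<tau> \<in> pointed_partitions n"
    by (simp add: covers_converse covers_pointed_partition_poset)
  \<comment> \<open>Using \<tau> itself as the lower end \<rho> makes \<open>dual_atomE\<close>
    applicable to a single edge.\<close>
  then have "(\<tau>, \<tau>) \<in> (pointed_partition_poset n)\<inverse>"
    by (simp add: pointed_partition_poset_refl)
  then show "dual_labeling pointed_labeling \<sigma> \<tau> \<in> Field ((label_poset n)\<inverse>)"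
    using dual_atomE[OF c] split_label_Field[OF tau] by (metis Field_converse)
qed

text \<open>Labels are compared first by the minimum of the block that is split. So splits of
  different blocks of \<sigma> are compared by minima alone, and only splits within one block need
  \<open>top_block_split\<close>.\<close>

lemma dual_atom_criterion:
  fixes n
  defines "P \<equiv> (pointed_partition_poset n)\<inverse>" and "\<Lambda> \<equiv> (label_poset n)\<inverse>"
    and "lab \<equiv> dual_labeling pointed_labeling"
  assumes le: "(\<sigma>, \<rho>) \<in> P" and "\<sigma> \<noteq> \<rho>"
  shows "\<exists>\<tau>. covers P \<sigma> \<tau> \<and> (\<tau>, \<rho>) \<in> P \<and>
    (\<forall>\<upsilon>. covers P \<tau> \<upsilon> \<longrightarrow> (\<upsilon>, \<rho>) \<in> P \<longrightarrow> (lab \<sigma> \<tau>, lab \<tau> \<upsilon>) \<in> \<Lambda> - Id) \<and>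
    (\<forall>\<tau>'. covers P \<sigma> \<tau>' \<longrightarrow> (\<tau>', \<rho>) \<in> P \<longrightarrow> \<tau>' \<noteq> \<tau> \<longrightarrow> (lab \<sigma> \<tau>, lab \<sigma> \<tau>') \<in> \<Lambda> - Id \<and>
      (\<exists>\<upsilon>. covers P \<tau>' \<upsilon> \<and> (\<upsilon>, \<rho>) \<in> P \<and> (lab \<sigma> \<tau>', lab \<tau>' \<upsilon>) \<notin> \<Lambda> - Id))"
proof -
  note atomI = dual_atomI[of _ _ n, folded P_def lab_def]
  note atomE = dual_atomE[of n, folded P_def lab_def]
  have rho: "\<rho> \<in> pointed_partitions n" and sigma: "\<sigma> \<in> pointed_partitions n" "finer \<rho> \<sigma>"
    using le by (auto simp: P_def pointed_partition_poset_iff)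
  have less: "(split_label c D d E, split_label c' D' d' E') \<in> \<Lambda> - Id \<longleftrightarrow>
      label_less (split_label c' D' d' E') (split_label c D d E)"
    if "block_split \<rho> C c D d E e" "block_split \<rho> C' c' D' d' E' e'"
    for C c D d E e C' c' D' d' E' e'
    unfolding \<Lambda>_def using that split_label_Field[OF rho] by (intro strict_label_poset_iff) blast+
  have same: "X = Y" "x = y" if "(X, x) \<in> \<sigma>" "(Y, y) \<in> \<sigma>" "Min X = Min Y" for X x Y y
  proof -
    have "Min X \<in> X" "Min Y \<in> Y"
      using saturated_finite(4)[OF rho] finerD[OF sigma(2)] that(1,2) by blast+
    then show "X = Y" "x = y"
      using same_block[OF sigma(1) that(1,2), of "Min X"] that(3) by simp_all
  qed
  \<comment> \<open>These are the blocks of \<sigma> that admit a split. Distinct blocks have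
    distinct minima, so the largest minimum singles out one of them.\<close>
  define N where "N = {(C, c) \<in> \<sigma>. C \<notin> fst ` \<rho>}"
  have "finite N"
    using finite_pointed_partition[OF sigma(1)] by (auto simp: N_def intro: finite_subset)
  moreover have "N \<noteq> {}"
    using ex_nontrivial_block[OF rho sigma assms(5)] by (auto simp: N_def)
  ultimately obtain Q where Q: "Q \<in> N" "\<And>R. R \<in> N \<Longrightarrow> Min (fst R) \<le> Min (fst Q)"
    using Max_in[of "(\<lambda>Q. Min (fst Q)) ` N"] Max_ge[of "(\<lambda>Q. Min (fst Q)) ` N"] by fastforce
  obtain C c where "Q = (C, c)" by (cases Q)
  then have C: "(C, c) \<in> \<sigma>" "C \<notin> fst ` \<rho>"
    and maxN: "\<And>X x. (X, x) \<in> N \<Longrightarrow> Min X \<le> Min C"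
    using Q by (force simp: N_def)+
  have max: "Min X < Min C \<or> (X, x) = (C, c)"
    if "(X, x) \<in> \<sigma>" "block_split \<rho> X x D d E e" for X x D d E e
  proof -
    have "(X, x) \<in> N" using that no_block_split by (simp add: N_def)
    then have "Min X \<le> Min C" by (rule maxN)
    then show ?thesis using same[OF that(1) C(1)] by force
  qed
  obtain D d E e where top: "block_split \<rho> C c D d E e" "E \<in> fst ` \<rho>"
    and other: "\<forall>D' d' E' e'. block_split \<rho> C c D' d' E' e' \<longrightarrow> (D', d', E', e') \<noteq> (D, d, E, e) \<longrightarrow>
       label_less (split_label c D' d' E') (split_label c D d E)"
    and below: "\<forall>D' d' E' e'. block_split \<rho> D d D' d' E' e' \<longrightarrow>
       label_less (split_label d D' d' E') (split_label c D d E)"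
    and descent: "\<forall>D' d' E' e'. block_split \<rho> C c D' d' E' e' \<longrightarrow> (D', d', E', e') \<noteq> (D, d, E, e) \<longrightarrow>
       E' \<in> fst ` \<rho> \<longrightarrow> (\<exists>D'' d'' E'' e''. block_split \<rho> D' d' D'' d'' E'' e'' \<and>
         \<not> label_less (split_label d' D'' d'' E'') (split_label c D' d' E'))"
    using top_block_split[OF rho finerD[OF sigma(2) C(1)] C(2)] by (elim exE conjE)
  have smaller: "label_less (split_label x X' x' Y') (split_label c D d E)"
    if "Min X < Min C" "block_split \<rho> X x X' x' Y' y'" for X x X' x' Y' y'
    using that block_split_Min[OF rho that(2)] block_split_Min[OF rho top(1)]
    by (simp add: split_label_def)
  define \<tau> where "\<tau> = replace_block \<sigma> C c D d E e"
  note tau = atomI[OF le C(1) top(1), folded \<tau>_def]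
  show ?thesis
  proof (rule exI[of _ \<tau>], intro conjI allI impI tau(1,2))
    fix \<upsilon> assume "covers P \<tau> \<upsilon>" "(\<upsilon>, \<rho>) \<in> P"
    then obtain X x X' x' Y' y' where X: "(X, x) \<in> \<tau>" "block_split \<rho> X x X' x' Y' y'"
        "lab \<tau> \<upsilon> = split_label x X' x' Y'"
      by (rule atomE)
    consider "(X, x) = (D, d)" | "(X, x) = (E, e)" | "(X, x) \<in> \<sigma>" "(X, x) \<noteq> (C, c)"
      using X(1) by (auto simp: \<tau>_def replace_block_def)
    then have "label_less (split_label x X' x' Y') (split_label c D d E)"
    proof cases
      case 1
      then show ?thesis using below X(2) by blast
    next
      case 2
      then show ?thesis using no_block_split[OF X(2)] top(2) by simp
    next
      case 3
      then show ?thesis using max[OF 3(1) X(2)] smaller[OF _ X(2)] by blast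
    qed
    then show "(lab \<sigma> \<tau>, lab \<tau> \<upsilon>) \<in> \<Lambda> - Id"
      unfolding tau(3) X(3) using less[OF top(1) X(2)] by blast
  next
    fix \<tau>' assume "covers P \<sigma> \<tau>'" and le': "(\<tau>', \<rho>) \<in> P" and ne: "\<tau>' \<noteq> \<tau>"
    then obtain X x X' x' Y' y' where X: "(X, x) \<in> \<sigma>" "block_split \<rho> X x X' x' Y' y'"
        "\<tau>' = replace_block \<sigma> X x X' x' Y' y'" "lab \<sigma> \<tau>' = split_label x X' x' Y'"
      using atomE by metis
    have ne': "(X', x', Y', y') \<noteq> (D, d, E, e)" if "(X, x) = (C, c)"
      using that ne X(3) by (auto simp: \<tau>_def)
    have "label_less (split_label x X' x' Y') (split_label c D d E)"
      using max[OF X(1,2)] smaller[OF _ X(2)] other ne' X(2) by blast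
    then show "(lab \<sigma> \<tau>, lab \<sigma> \<tau>') \<in> \<Lambda> - Id"
      unfolding tau(3) X(4) using less[OF top(1) X(2)] by blast
    have "\<exists>Z z Z' z' W' w'. (Z, z) \<in> \<tau>' \<and> block_split \<rho> Z z Z' z' W' w' \<and>
        \<not> label_less (split_label z Z' z' W') (split_label x X' x' Y')"
    proof (cases "(X, x) = (C, c)")
      \<comment> \<open>\<tau>' leaves \<open>C\<close> whole, and splitting it next gives a label
        with larger first entry.\<close>
      case False
      then have "(C, c) \<in> \<tau>'" "Min X < Min C"
        using C(1) X(3) max[OF X(1,2)] by (auto simp: replace_block_def)
      moreover have "\<not> label_less (split_label c D d E) (split_label x X' x' Y')"
        using \<open>Min X < Min C\<close> block_split_Min[OF rho X(2)] block_split_Min[OF rho top(1)]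
        by (simp add: split_label_def)
      ultimately show ?thesis using top(1) by blast
    next
      case True
      have in': "(X', x') \<in> \<tau>'" "(Y', y') \<in> \<tau>'" using X(3) by (auto simp: replace_block_def)
      show ?thesis
      proof (cases "Y' \<in> fst ` \<rho>")
        case Y: True
        show ?thesis
          using descent[rule_format, OF _ ne'[OF True] Y] X(2) True in'(1) by blast
      next
        \<comment> \<open>\<open>Y'\<close> can be split further, with first entry
          \<open>Min Y'\<close>, which exceeds the first entry \<open>Min X'\<close> of the label
          just used.\<close>
        case False
        have "saturated \<rho> Y' y'" using X(2) by (simp add: block_split_def)
        then obtain Z' z' W' w' where s: "block_split \<rho> Y' y' Z' z' W' w'"
          using ex_block_split[OF rho _ False] by blast
        have "Min X' < Min Z'"
          using X(2) block_split_Min[OF rho s] by (simp add: block_split_def)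
        then have "\<not> label_less (split_label y' Z' z' W') (split_label x X' x' Y')"
          by (simp add: split_label_def)
        then show ?thesis using s in'(2) by blast
      qed
    qed
    then obtain Z z Z' z' W' w' where Z: "(Z, z) \<in> \<tau>'" "block_split \<rho> Z z Z' z' W' w'"
        "\<not> label_less (split_label z Z' z' W') (split_label x X' x' Y')"
      by blast
    note ups = atomI[OF le' Z(1,2)]
    show "\<exists>\<upsilon>. covers P \<tau>' \<upsilon> \<and> (\<upsilon>, \<rho>) \<in> P \<and> (lab \<sigma> \<tau>', lab \<tau>' \<upsilon>) \<notin> \<Lambda> - Id"
      using ups less[OF X(2) Z(2)] Z(3) X(4) by metis
  qed
qed

theorem theorem2p15:
  fixes n :: nat
  assumes "n \<ge> 1"
  shows "EL_labeling ((pointed_partition_poset n)\<inverse>) ((label_poset n)\<inverse>) (dual_labeling pointed_labeling) \<and>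
    (\<forall>I \<in> maximal_intervals ((pointed_partition_poset n)\<inverse>).
       EL_shellable (Restr ((pointed_partition_poset n)\<inverse>) I))"
proof -
  let ?P = "(pointed_partition_poset n)\<inverse>"
  have "pointed_partition_poset n \<subseteq> pointed_partitions n \<times> pointed_partitions n"
    by (auto dest: pointed_partition_posetD(1,2))
  then have fin: "finite ?P"
    using finite_pointed_partitions by (simp add: finite_subset)
  have EL: "EL_labeling ?P ((label_poset n)\<inverse>) (dual_labeling pointed_labeling)"
  proof (rule EL_labeling_atom_criterion[OF _ fin _ dual_edge_labeling dual_atom_criterion])
    show "Partial_order ?P"
      using Partial_order_pointed_partition_poset by (simp only: partial_order_on_converse Field_converse)
    show "Partial_order ((label_poset n)\<inverse>)"
      using Partial_order_label_poset by (simp only: partial_order_on_converse Field_converse)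
  qed
  moreover have "EL_shellable (Restr ?P I)" if I: "I \<in> maximal_intervals ?P" for I
  proof -
    obtain x y where "I = closed_interval ?P x y" "(x, y) \<in> ?P"
      using I unfolding maximal_intervals_def closed_intervals_def by blast
    then show ?thesis using EL_shellable_closed_interval[OF EL fin] by blast
  qed
  ultimately show ?thesis by blast
qed

end
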